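(* Fix $d\ge1$ and let $\beta,y_1,y_2,\dots$ be indeterminates. For all partitions $\mu\subseteq\lambda$ with $\ell(\lambda)\le d$ (set $\lambda_i=0$ for $i>\ell(\lambda)$), $$\sum_{T\in\operatorname{SIT}(\lambda/\mu)}\prod_{k=1}^{m(T)}\left(\left[\prod_{i=1}^d\frac{1+\beta\,y_{\nu_i(T_{<k})+d-i+1}}{1+\beta\,y_{\lambda_i+d-i+1}}\right]-1\right)^{-1}=\sum_{D\in\mathcal D(\lambda/\mu)}\beta^{|D|-|\lambda|}\prod_{(i,j)\in\lambda\setminus D}\frac{\beta\,y_{\lambda_i+d-i+1}+1}{y_{d+j-\lambda'_j}-y_{\lambda_i+d+1-i}}$$ as rational functions.
   Context: Partitions are identified with Young diagrams $\{(i,j):1\le j\le\lambda_i\}$ (English convention); $\lambda'$ is the conjugate; $|\cdot|$ counts cells. A standard increasing tableau of shape $\lambda/\mu$ is a filling $T$ of the cells of $\lambda/\mu$ by positive integers, strictly increasing along rows and down columns, with set of entries $\{1,\dots,m\}$ for some $m=m(T)$; $\operatorname{SIT}(\lambda/\mu)$ is their set. $\nu(T_{<k})$ is the partition whose diagram is $\mu$ together with the cells of $\lambda/\mu$ with entry $<k$, with parts $\nu_i(T_{<k})$. Generalized excited diagrams: for $S\subseteq\lambda$, a cell $(i,j)\in S$ is active if $(i+1,j),(i,j+1),(i+1,j+1)\in\lambda\setminus S$; for active $(i,j)$ the type I move replaces $(i,j)$ by $(i+1,j+1)$ and the type II move adds $(i+1,j+1)$ to $S$. $\mathcal D(\lambda/\mu)$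 is the set of subsets of $\lambda$ obtainable from the diagram of $\mu$ by sequences of type I and II moves. *)

theory Defs
  imports Main
begin

definition is_partition :: "nat list \<Rightarrow> bool" where
  "is_partition la \<longleftrightarrow> sorted_wrt (\<ge>) la \<and> 0 \<notin> set la"

definition part :: "nat list \<Rightarrow> nat \<Rightarrow> nat" where
  "part la i = (if 1 \<le> i \<and> i \<le> length la then la ! (i - 1) else 0)"

definition diagram :: "nat list \<Rightarrow> (nat \<times> nat) set" where
  "diagram la = {(i, j). 1 \<le> i \<and> 1 \<le> j \<and> j \<le> part la i}"

definition conj_part :: "nat list \<Rightarrow> nat \<Rightarrow> nat" where
  "conj_part la j = card {i. 1 \<le> i \<and> j \<le> part la i \<and> i \<le> length la}"

definition skew :: "nat list \<Rightarrow> nat list \<Rightarrow> (nat \<times> nat) set" where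
  "skew la mu = diagram la - diagram mu"

text \<open>Standard increasing tableaux of shape la/mu; a tableau is a function on cells,
  normalised to 0 outside the skew shape.\<close>
definition SIT :: "nat list \<Rightarrow> nat list \<Rightarrow> ((nat \<times> nat) \<Rightarrow> nat) set" where
  "SIT la mu = {T.
     (\<forall>c. c \<notin> skew la mu \<longrightarrow> T c = 0) \<and>
     (\<forall>i j. (i, j) \<in> skew la mu \<and> (i, j + 1) \<in> skew la mu \<longrightarrow> T (i, j) < T (i, j + 1)) \<and>
     (\<forall>i j. (i, j) \<in> skew la mu \<and> (i + 1, j) \<in> skew la mu \<longrightarrow> T (i, j) < T (i + 1, j)) \<and>
     (\<exists>m. T ` skew la mu = {1..m})}"

text \<open>m(T): the largest entry (number of distinct entries)\<close>
definition mT :: "nat list \<Rightarrow> nat list \<Rightarrow> ((nat \<times> nat) \<Rightarrow> nat) \<Rightarrow> nat" where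
  "mT la mu T = card (T ` skew la mu)"

definition nu_part :: "nat list \<Rightarrow> nat list \<Rightarrow> ((nat \<times> nat) \<Rightarrow> nat) \<Rightarrow> nat \<Rightarrow> nat \<Rightarrow> nat" where
  "nu_part la mu T k i =
     card {j. (i, j) \<in> diagram mu \<union> {c \<in> skew la mu. T c < k}}"

definition active :: "nat list \<Rightarrow> (nat \<times> nat) set \<Rightarrow> nat \<times> nat \<Rightarrow> bool" where
  "active la S c \<longleftrightarrow> (case c of (i, j) \<Rightarrow>
     (i, j) \<in> S \<and> (i + 1, j) \<in> diagram la - S \<and> (i, j + 1) \<in> diagram la - S
     \<and> (i + 1, j + 1) \<in> diagram la - S)"

inductive_set gen_excited :: "nat list \<Rightarrow> nat list \<Rightarrow> (nat \<times> nat) set set"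
  for la mu where
  init: "diagram mu \<in> gen_excited la mu"
| typeI: "\<lbrakk>S \<in> gen_excited la mu; active la S (i, j)\<rbrakk>
          \<Longrightarrow> (S - {(i, j)}) \<union> {(i + 1, j + 1)} \<in> gen_excited la mu"
| typeII: "\<lbrakk>S \<in> gen_excited la mu; active la S (i, j)\<rbrakk>
          \<Longrightarrow> S \<union> {(i + 1, j + 1)} \<in> gen_excited la mu"

end

theory Submission
  imports Defs "HOL-Library.Product_Lexorder"
begin

text \<open>
  Encode a partition \<open>g\<close> with at most \<open>d\<close> rows by the set of particles at the positions
  \<open>g i + d - i + 1\<close>, and put \<open>z q = 1 + \<beta> y q\<close>. The 0-Hecke generator at \<open>p\<close> moves a particle from
  \<open>p\<close> to \<open>p + 1\<close>, fixes a state with a particle at \<open>p + 1\<close> only, and kills all others.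
  Reading the cells of \<open>\<lambda>\<close> row by row, the generalized excited diagrams of \<open>\<lambda>/\<mu>\<close> are exactly
  the subsets whose 0-Hecke word takes the empty partition to \<open>\<mu>\<close>. Up to a common factor the
  right-hand side is thus the coefficient \<open>v(\<mu>)\<close> of \<open>\<mu>\<close> in a product of operators
  \<open>1 + (z p / z (p + 1) - 1) T p\<close>, with variables permuted from cell to cell.

  The tableaux sum is determined by removing the cells with entry 1, which form a nonempty set
  of addable cells of \<open>\<mu>\<close>. The two sides agree once \<open>v\<close> satisfies the same recurrence
  \<open>w(\<mu>) v(\<mu>) = w(\<lambda>) \<Sum> v(\<nu>)\<close>, where \<open>w\<close> is the product of \<open>z\<close> over the particles and \<open>\<nu>\<close>
  runs over all ways to add a (possibly empty) set of addable cells to \<open>\<mu>\<close>. This follows by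
  induction on the cells of \<open>\<lambda>\<close>: adding a cell swaps two variables, and the operator
  \<open>v \<mapsto> \<Sum> v(\<nu>)\<close> intertwines \<open>T p\<close> with another idempotent local operator.
\<close>

section \<open>Particle configurations and addable sets\<close>

definition addable :: "nat set \<Rightarrow> nat set" where
  "addable s = {q \<in> s. Suc q \<notin> s}"

definition mv :: "nat set \<Rightarrow> nat set \<Rightarrow> nat set" where
  "mv s Q = (s - Q) \<union> Suc ` Q"

text \<open>For the particles of a partition, the sets \<open>Q\<close> stand for the sets of
  addable cells, the empty set included; this is the summation operator of the recurrence.\<close>

definition up_sum :: "(nat set \<Rightarrow> 'a::comm_monoid_add) \<Rightarrow> nat set \<Rightarrow> 'a" where
  "up_sum v s = (\<Sum>Q\<in>Pow (addable s). v (mv s Q))"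

text \<open>Transpose of the generator \<open>hecke p\<close> introduced below: it sums
  \<open>v\<close> over the preimages of \<open>s\<close>, of which there are two or none.\<close>

definition hecke_dual :: "nat \<Rightarrow> (nat set \<Rightarrow> 'a::comm_monoid_add) \<Rightarrow> nat set \<Rightarrow> 'a" where
  "hecke_dual p v s =
    (if p \<notin> s \<and> Suc p \<in> s then v s + v (insert p (s - {Suc p})) else 0)"

section \<open>Commuting \<open>up_sum\<close> past the Hecke operators\<close>

lemma sum_Pow_insert:
  assumes "finite A" "x \<notin> A"
  shows "sum f (Pow (insert x A)) = (\<Sum>Q\<in>Pow A. f Q + f (insert x Q))"
proof -
  have "inj_on (insert x) (Pow A)"
    using assms(2) by (auto simp: inj_on_def)
  moreover have "Pow A \<inter> insert x ` Pow A = {}"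
    using assms(2) by auto
  ultimately show ?thesis
    using assms(1) by (simp add: Pow_insert sum.union_disjoint sum.reindex sum.distrib)
qed

lemma finite_addable: "finite s \<Longrightarrow> finite (addable s)"
  by (simp add: addable_def)

lemma mv_empty [simp]: "mv s {} = s"
  by (simp add: mv_def)

text \<open>If \<open>Q\<close> leaves \<open>p\<close> in place, \<open>p\<close> stays occupied
  and the term vanishes. If \<open>Q\<close> moves \<open>p\<close>, the two preimages are the
  results of \<open>Q\<close> with and without \<open>p\<close>, so every term of
  \<open>up_sum v s\<close> reappears once.\<close>

lemma up_sum_hecke_dual_movable:
  assumes "finite s" "p \<in> s" "Suc p \<notin> s"
  shows "up_sum (hecke_dual p v) s = up_sum v s"
proof -
  let ?A = "addable s - {p}"
  have A: "addable s = insert p ?A"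
    using assms by (auto simp: addable_def)
  have fin: "finite ?A" using assms(1) finite_addable by auto
  have 1: "hecke_dual p v (mv s Q) = 0" if "Q \<subseteq> ?A" for Q
    using that assms by (auto simp: hecke_dual_def mv_def)
  have 2: "hecke_dual p v (mv s (insert p Q)) = v (mv s Q) + v (mv s (insert p Q))"
    if "Q \<subseteq> ?A" for Q
  proof -
    have a: "p \<notin> mv s (insert p Q)" "Suc p \<in> mv s (insert p Q)"
      using that assms by (auto simp: mv_def addable_def)
    have b: "insert p (mv s (insert p Q) - {Suc p}) = mv s Q"
      using that assms by (auto simp: mv_def addable_def)
    show ?thesis using a b by (simp add: hecke_dual_def add.commute)
  qed
  have "up_sum (hecke_dual p v) s
      = (\<Sum>Q\<in>Pow ?A. hecke_dual p v (mv s Q) + hecke_dual p v (mv s (insert p Q)))"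
    unfolding up_sum_def by (subst A, rule sum_Pow_insert[OF fin]) simp
  also have "\<dots> = (\<Sum>Q\<in>Pow ?A. v (mv s Q) + v (mv s (insert p Q)))"
    using 1 2 by (intro sum.cong) auto
  also have "\<dots> = up_sum v s"
    unfolding up_sum_def by (subst (2) A, rule sum_Pow_insert[OF fin, symmetric]) simp
  finally show ?thesis .
qed

text \<open>Only those \<open>Q\<close> survive that keep the particle at \<open>Suc p\<close> and
  do not fill \<open>p\<close> from the left. Their two preimages are the choices of keeping or
  moving the particle at \<open>p\<close> in the pulled-back configuration.\<close>

lemma up_sum_hecke_dual_moved:
  assumes "finite s" "p \<notin> s" "Suc p \<in> s"
  shows "up_sum (hecke_dual p v) s = up_sum v (insert p (s - {Suc p}))"
proof -
  let ?s = "insert p (s - {Suc p})"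
  let ?A = "{q \<in> addable s. q \<noteq> Suc p \<and> Suc q \<noteq> p}"
  have A: "addable ?s = insert p ?A"
    using assms by (auto simp: addable_def)
  have fin: "finite ?A" using assms(1) finite_addable by auto
  have p: "p \<notin> ?A" using assms by (simp add: addable_def)
  have 1: "hecke_dual p v (mv s Q) = 0" if "Q \<subseteq> addable s" "\<not> Q \<subseteq> ?A" for Q
  proof -
    from that consider "Suc p \<in> Q" | q where "q \<in> Q" "Suc q = p" by blast
    then show ?thesis
    proof cases
      case 1
      then have "Suc p \<notin> mv s Q" using that(1) assms by (auto simp: mv_def addable_def)
      then show ?thesis by (simp add: hecke_dual_def)
    next
      case 2
      then have "p \<in> mv s Q" by (auto simp: mv_def)
      then show ?thesis by (simp add: hecke_dual_def)
    qed
  qed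
  have 2: "hecke_dual p v (mv s Q) = v (mv ?s Q) + v (mv ?s (insert p Q))"
    if "Q \<subseteq> ?A" for Q
  proof -
    have a: "p \<notin> mv s Q" "Suc p \<in> mv s Q"
      using that assms by (auto simp: mv_def addable_def)
    have b: "insert p (mv s Q - {Suc p}) = mv ?s Q"
      using that assms by (auto simp: mv_def addable_def)
    have c: "mv s Q = mv ?s (insert p Q)"
      using that assms by (auto simp: mv_def addable_def)
    show ?thesis using a b c by (simp add: hecke_dual_def add.commute)
  qed
  have "up_sum (hecke_dual p v) s = (\<Sum>Q\<in>Pow ?A. hecke_dual p v (mv s Q))"
    unfolding up_sum_def
    using 1 finite_addable[OF assms(1)] by (intro sum.mono_neutral_right) auto
  also have "\<dots> = (\<Sum>Q\<in>Pow ?A. v (mv ?s Q) + v (mv ?s (insert p Q)))"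
    using 2 by (intro sum.cong) auto
  also have "\<dots> = up_sum v ?s"
    unfolding up_sum_def A by (rule sum_Pow_insert[OF fin p, symmetric])
  finally show ?thesis .
qed

text \<open>If both positions are occupied, \<open>p\<close> is blocked and stays occupied; if both
  are empty, nothing can move into \<open>Suc p\<close>. No result has a hole at \<open>p\<close>
  and a particle at \<open>Suc p\<close>.\<close>

lemma up_sum_hecke_dual_stuck:
  assumes "p \<in> s \<longleftrightarrow> Suc p \<in> s"
  shows "up_sum (hecke_dual p v) s = 0"
  unfolding up_sum_def
proof (rule sum.neutral, rule ballI)
  fix Q assume "Q \<in> Pow (addable s)"
  then have "\<not> (p \<notin> mv s Q \<and> Suc p \<in> mv s Q)"
    using assms by (auto simp: mv_def addable_def)
  then show "hecke_dual p v (mv s Q) = 0" by (auto simp: hecke_dual_def)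
qed

text \<open>How the recurrence survives one more cell. If only \<open>p\<close> is occupied, passing
  to \<open>v'\<close> multiplies \<open>up_sum\<close> by \<open>z p / z (Suc p)\<close>, just as
  undoing the swap multiplies the product over \<open>s\<close>. If only \<open>Suc p\<close> is,
  the old equations at \<open>s\<close> and at the pulled-back configuration combine linearly.
  Otherwise the swap preserves the product and the Hecke terms vanish.\<close>

lemma up_sum_step:
  fixes z :: "nat \<Rightarrow> 'a::field"
  assumes eq: "\<And>s. finite s \<Longrightarrow> 0 \<notin> s \<Longrightarrow>
      prod (z(p := z (Suc p), Suc p := z p)) s * v s = \<omega> * up_sum v s"
    and p: "0 < p" and z: "z (Suc p) \<noteq> 0" and s: "finite s" "0 \<notin> s"
    and v': "\<And>s. v' s = v s + (z p / z (Suc p) - 1) * hecke_dual p v s"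
  shows "prod z s * v' s = \<omega> * up_sum v' s"
proof -
  let ?z = "z(p := z (Suc p), Suc p := z p)"
  let ?r = "z p / z (Suc p)"
  have C: "up_sum v' s = up_sum v s + (?r - 1) * up_sum (hecke_dual p v) s"
    unfolding up_sum_def v' by (simp add: sum.distrib sum_distrib_left)
  have cong: "prod ?z S = prod z S" if "p \<notin> S" "Suc p \<notin> S" for S
    using that by (intro prod.cong) auto
  consider (a) "p \<in> s" "Suc p \<notin> s" | (b) "p \<notin> s" "Suc p \<in> s"
    | (c) "p \<in> s" "Suc p \<in> s" | (d) "p \<notin> s" "Suc p \<notin> s" by blast
  then show ?thesis
  proof cases
    case a
    define R where "R = prod z (s - {p})"
    have R: "prod ?z (s - {p}) = R" unfolding R_def using a by (intro cong) auto
    have w: "prod z s = z p * R" "prod ?z s = z (Suc p) * R"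
      using s(1) a R R_def by (simp_all add: prod.remove)
    have 1: "v' s = v s" using a v' by (simp add: hecke_dual_def)
    have 2: "up_sum v' s = ?r * up_sum v s"
      using C a s(1) by (simp add: up_sum_hecke_dual_movable algebra_simps)
    have 3: "\<omega> * up_sum v s = z (Suc p) * R * v s"
      using eq[OF s] w by simp
    have "\<omega> * up_sum v' s = ?r * (\<omega> * up_sum v s)" by (simp add: 2)
    also have "\<dots> = prod z s * v' s" using z by (simp add: 1 3 w)
    finally show ?thesis by simp
  next
    case b
    let ?s = "insert p (s - {Suc p})"
    define R where "R = prod z (s - {Suc p})"
    have R: "prod ?z (s - {Suc p}) = R" unfolding R_def using b by (intro cong) auto
    have w: "prod z s = z (Suc p) * R" "prod ?z s = z p * R"
      using s(1) b R R_def by (simp_all add: prod.remove)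
    have w': "prod ?z ?s = z (Suc p) * R"
      using s(1) b R by simp
    have 1: "v' s = v s + (?r - 1) * (v s + v ?s)" using b v' by (simp add: hecke_dual_def)
    have 2: "up_sum v' s = up_sum v s + (?r - 1) * up_sum v ?s"
      using C b s(1) by (simp add: up_sum_hecke_dual_moved)
    have 3: "\<omega> * up_sum v s = z p * R * v s"
      using eq[OF s] w by simp
    \<comment> \<open>\<open>0 < p\<close> keeps \<open>0\<close> out of the pulled-back
      configuration.\<close>
    have 4: "\<omega> * up_sum v ?s = z (Suc p) * R * v ?s"
      using eq[of ?s] w' s p by simp
    have "\<omega> * up_sum v' s = \<omega> * up_sum v s + (?r - 1) * (\<omega> * up_sum v ?s)"
      by (simp add: 2 algebra_simps)
    also have "\<dots> = z p * R * v s + (?r - 1) * (z (Suc p) * R * v ?s)"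
      by (simp only: 3 4)
    also have "\<dots> = prod z s * v' s"
      using z by (simp add: 1 w field_simps)
    finally show ?thesis by simp
  next
    case c
    have pp: "prod f s = f p * (f (Suc p) * prod f (s - {p} - {Suc p}))" for f :: "nat \<Rightarrow> 'a"
      using s(1) c by (subst prod.remove[of s p], simp_all, subst prod.remove[of "s - {p}" "Suc p"]) auto
    have "prod ?z s = prod z s"
      by (simp add: pp cong mult_ac)
    then show ?thesis using eq[OF s] C c v' by (simp add: up_sum_hecke_dual_stuck hecke_dual_def)
  next
    case d
    have "prod ?z s = prod z s" using d by (rule cong)
    then show ?thesis using eq[OF s] C d v' by (simp add: up_sum_hecke_dual_stuck hecke_dual_def)
  qed
qed

text \<open>The least moved particle would leave a hole at a positive position with a particle
  directly after it, which an interval starting at \<open>1\<close> does not have. So only the empty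
  move reaches the empty partition.\<close>

lemma mv_eq_interval:
  assumes "finite s" "0 \<notin> s" "Q \<subseteq> addable s" "mv s Q = {1..d}"
  shows "Q = {}"
proof (rule ccontr)
  assume "Q \<noteq> {}"
  moreover have "finite Q" using assms finite_addable finite_subset by blast
  ultimately have Q: "Min Q \<in> Q" "\<And>q. q \<in> Q \<Longrightarrow> Min Q \<le> q" by auto
  have "Min Q \<notin> mv s Q"
    using Q by (auto simp: mv_def dest!: Q(2))
  moreover have "Suc (Min Q) \<in> mv s Q"
    using Q(1) by (auto simp: mv_def)
  moreover have "Min Q \<in> s" using Q(1) assms(3) by (auto simp: addable_def)
  ultimately show False using assms(2,4) by (cases "Min Q") auto
qed

section \<open>Partitions and the Hecke action\<close>

definition shape :: "(nat \<Rightarrow> nat) \<Rightarrow> (nat \<times> nat) set" where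
  "shape f = {(i, j). 1 \<le> i \<and> 1 \<le> j \<and> j \<le> f i}"

text \<open>Rows are indexed from 1 and the value at 0 is unconstrained, so equality of partitions
  is expressed through \<open>shape\<close>.\<close>

definition ptn :: "nat \<Rightarrow> (nat \<Rightarrow> nat) \<Rightarrow> bool" where
  "ptn d f \<longleftrightarrow> (\<forall>i\<ge>1. f (Suc i) \<le> f i) \<and> (\<forall>i>d. f i = 0)"

text \<open>The index that \<open>y\<close> carries for row \<open>i\<close> in the theorem; the
  subtraction is exact for \<open>i\<close> up to \<open>d\<close>.\<close>

definition position :: "nat \<Rightarrow> (nat \<Rightarrow> nat) \<Rightarrow> nat \<Rightarrow> nat" where
  "position d f i = f i + d - i + 1"

definition particles :: "nat \<Rightarrow> (nat \<Rightarrow> nat) \<Rightarrow> nat set" where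
  "particles d f = position d f ` {1..d}"

lemma ptn_mono:
  assumes "ptn d f" "1 \<le> i" "i \<le> k"
  shows "f k \<le> f i"
  using assms(3)
proof (induction rule: dec_induct)
  case (step n)
  then have "f (Suc n) \<le> f n" using assms by (simp add: ptn_def)
  with step show ?case by simp
qed simp

lemma ptn_zero: "ptn d f \<Longrightarrow> d < i \<Longrightarrow> f i = 0"
  by (simp add: ptn_def)

lemma shape_row_le: "ptn d f \<Longrightarrow> (i, j) \<in> shape f \<Longrightarrow> i \<le> d"
  using ptn_zero[of d f i] by (cases "d < i") (auto simp: shape_def)

lemma finite_shape:
  assumes "ptn d f" shows "finite (shape f)"
proof (rule finite_subset)
  show "shape f \<subseteq> {1..d} \<times> {1..f 1}"
  proof
    fix c assume c: "c \<in> shape f"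
    obtain i j where ij: "c = (i, j)" by force
    with c have "i \<le> d" "1 \<le> i" "1 \<le> j" "j \<le> f i"
      using shape_row_le[OF assms] by (auto simp: shape_def)
    moreover have "f i \<le> f 1" using ptn_mono[OF assms, of 1 i] \<open>1 \<le> i\<close> by simp
    ultimately show "c \<in> {1..d} \<times> {1..f 1}" by (simp add: ij)
  qed
qed simp

lemma position_strict:
  "ptn d f \<Longrightarrow> 1 \<le> i \<Longrightarrow> i < k \<Longrightarrow> k \<le> d \<Longrightarrow> position d f k < position d f i"
  using ptn_mono[of d f i k] by (simp add: position_def)

lemma inj_on_position:
  assumes "ptn d f" shows "inj_on (position d f) {1..d}"
proof (rule inj_onI)
  fix i k assume "i \<in> {1..d}" "k \<in> {1..d}" "position d f i = position d f k"
  then show "i = k"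
    using position_strict[OF assms, of i k] position_strict[OF assms, of k i]
    by (cases i k rule: linorder_cases) auto
qed

text \<open>Positions strictly decrease with the row, so the particles to the right belong to the
  rows above. This recovers the row of a particle from the bare set.\<close>

lemma particles_card_above:
  assumes "ptn d f" "i \<in> {1..d}"
  shows "card {q \<in> particles d f. position d f i < q} = i - 1"
proof -
  have "{q \<in> particles d f. position d f i < q} = position d f ` {1..<i}"
  proof (rule set_eqI)
    fix q
    have "position d f i < position d f k \<longleftrightarrow> k < i" if "k \<in> {1..d}" for k
      using position_strict[OF assms(1), of i k] position_strict[OF assms(1), of k i] assms(2) that
      by (cases i k rule: linorder_cases) auto
    then show "q \<in> {q \<in> particles d f. position d f i < q} \<longleftrightarrow> q \<in> position d f ` {1..<i}"
      using assms(2) by (fastforce simp: particles_def)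
  qed
  moreover have "inj_on (position d f) {1..<i}"
    using assms by (intro inj_on_subset[OF inj_on_position[OF assms(1)]]) auto
  ultimately show ?thesis by (simp add: card_image)
qed

text \<open>The number of particles to its right tells the row of a particle, and its position then
  tells the length of that row.\<close>

lemma particles_inject:
  assumes f: "ptn d f" and g: "ptn d g" and eq: "particles d f = particles d g"
  shows "shape f = shape g"
proof -
  have "f i = g i" if "1 \<le> i" for i
  proof (cases "i \<le> d")
    case True
    with that have i: "i \<in> {1..d}" by simp
    then have "position d f i \<in> particles d g" unfolding eq[symmetric] unfolding particles_def by (rule imageI)
    then obtain k where k: "k \<in> {1..d}" "position d f i = position d g k"
      by (auto simp: particles_def)
    have "i - 1 = k - 1"
      using particles_card_above[OF f i] particles_card_above[OF g k(1)] by (simp add: k(2) eq)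
    then have "i = k" using i k(1) by auto
    then have "f i + d - i = g i + d - i" "i \<le> d" using k(2) i by (simp_all add: position_def)
    then show ?thesis by linarith
  next
    case False
    then show ?thesis using f g by (simp add: ptn_def)
  qed
  then show ?thesis by (auto simp: shape_def)
qed

section \<open>0-Hecke words, with \<open>None\<close> for an annihilated state\<close>

definition hecke :: "nat \<Rightarrow> nat set \<Rightarrow> nat set option" where
  "hecke p s = (if p \<in> s \<and> Suc p \<notin> s then Some (insert (Suc p) (s - {p}))
     else if p \<notin> s \<and> Suc p \<in> s then Some s else None)"

definition hecke_word :: "nat list \<Rightarrow> nat set option \<Rightarrow> nat set option" where
  "hecke_word ps s = foldl (\<lambda>s p. Option.bind s (hecke p)) s ps"

text \<open>The usual content shifted by \<open>d\<close>: it is the position of the particle that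
  moves when the cell is added.\<close>

definition content :: "nat \<Rightarrow> nat \<times> nat \<Rightarrow> nat" where
  "content d c = d + snd c - fst c"

text \<open>The initial state \<open>{1..d}\<close> is the configuration of the empty
  partition.\<close>

definition run :: "nat \<Rightarrow> (nat \<times> nat) list \<Rightarrow> (nat \<times> nat) set \<Rightarrow> nat set option" where
  "run d cs D = hecke_word (map (content d) (filter (\<lambda>c. c \<in> D) cs)) (Some {1..d})"

lemma hecke_word_append: "hecke_word (ps @ qs) s = hecke_word qs (hecke_word ps s)"
  by (simp add: hecke_word_def)

lemma hecke_word_simps [simp]:
  "hecke_word [] s = s"
  "hecke_word (p # ps) s = hecke_word ps (Option.bind s (hecke p))"
  by (simp_all add: hecke_word_def)

lemma hecke_idem: "Option.bind (hecke p s) (hecke p) = hecke p s"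
  by (auto simp: hecke_def)

lemma hecke_commute:
  assumes "p + 2 \<le> q \<or> q + 2 \<le> p"
  shows "Option.bind (hecke p s) (hecke q) = Option.bind (hecke q s) (hecke p)"
  using assms by (auto simp: hecke_def)

lemma hecke_word_commute:
  assumes "\<forall>q\<in>set ps. p + 2 \<le> q \<or> q + 2 \<le> p"
  shows "hecke_word ps (Option.bind s (hecke p)) = Option.bind (hecke_word ps s) (hecke p)"
  using assms
proof (induction ps arbitrary: s)
  case (Cons q ps)
  have "Option.bind (Option.bind s (hecke p)) (hecke q) = Option.bind (Option.bind s (hecke q)) (hecke p)"
    using Cons.prems hecke_commute[of p q] by (cases s) auto
  then have "hecke_word (q # ps) (Option.bind s (hecke p))
      = hecke_word ps (Option.bind (Option.bind s (hecke q)) (hecke p))"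
    by (simp only: hecke_word_simps)
  also have "\<dots> = Option.bind (hecke_word (q # ps) s) (hecke p)"
    using Cons.prems by (subst Cons.IH) simp_all
  finally show ?case .
qed simp

lemma run_snoc:
  "run d (cs @ [x]) D =
    (if x \<in> D then Option.bind (run d cs D) (hecke (content d x)) else run d cs D)"
  by (simp add: run_def hecke_word_append)

lemma run_cong: "(\<And>c. c \<in> set cs \<Longrightarrow> c \<in> D \<longleftrightarrow> c \<in> D') \<Longrightarrow> run d cs D = run d cs D'"
  unfolding run_def by (metis (mono_tags, lifting) filter_cong)

text \<open>The contents read strictly between \<open>(i, j)\<close> and \<open>(i + 1, j + 1)\<close> differ by at least 2
  from that of \<open>(i, j)\<close>, so the letter of \<open>(i, j)\<close> can be commuted to \<open>(i + 1, j + 1)\<close>.\<close>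

lemma run_excited:
  assumes cs: "sorted_wrt (<) cs" "(i, j) \<in> set cs" "(Suc i, Suc j) \<in> set cs" "i < d"
    and D: "(i, j) \<in> D" "(Suc i, j) \<notin> D" "(i, Suc j) \<notin> D" "(Suc i, Suc j) \<notin> D"
  shows "run d cs (insert (Suc i, Suc j) (D - {(i, j)})) = run d cs D"
    and "run d cs (insert (Suc i, Suc j) D) = run d cs D"
proof -
  obtain as bs where 1: "cs = as @ (i, j) # bs" using cs(2) by (meson split_list)
  have "(Suc i, Suc j) \<in> set bs" using cs(1,3) by (auto simp: 1 sorted_wrt_append)
  then obtain ms ps where 2: "bs = ms @ (Suc i, Suc j) # ps" by (meson split_list)
  note s = cs(1)[unfolded 1 2]
  let ?p = "content d (i, j)"
  let ?w = "\<lambda>D xs. map (content d) (filter (\<lambda>c. c \<in> D) xs)"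
  have p': "content d (Suc i, Suc j) = ?p" by (simp add: content_def)
  \<comment> \<open>The cells in between lie in row \<open>i\<close> right of column
    \<open>j\<close> or in row \<open>Suc i\<close> up to column \<open>j\<close>. Only
    \<open>(i, Suc j)\<close> and \<open>(Suc i, j)\<close> among them have a content adjacent to
    \<open>?p\<close>, and both are outside \<open>D\<close>.\<close>
  have far: "\<forall>q\<in>set (?w D ms). ?p + 2 \<le> q \<or> q + 2 \<le> ?p"
  proof
    fix q assume "q \<in> set (?w D ms)"
    then obtain a b where c: "(a, b) \<in> set ms" "(a, b) \<in> D" "q = content d (a, b)" by auto
    have "(i, j) < x \<and> x < (Suc i, Suc j)" if "x \<in> set ms" for x
      using s that by (simp add: sorted_wrt_append)
    from this[OF c(1)] have lt: "(i, j) < (a, b)" "(a, b) < (Suc i, Suc j)"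
      by blast+
    have ne: "(a, b) \<noteq> (Suc i, j)" "(a, b) \<noteq> (i, Suc j)" using c(2) D by auto
    from lt have "(a = i \<and> j < b) \<or> (a = Suc i \<and> b < Suc j)"
      by auto
    then show "?p + 2 \<le> q \<or> q + 2 \<le> ?p"
      using ne cs(4) c(3) by (auto simp: content_def)
  qed
  define E F where "E = insert (Suc i, Suc j) (D - {(i, j)})" and "F = insert (Suc i, Suc j) D"
  have EF: "(i, j) \<notin> E" "(Suc i, Suc j) \<in> E" "(i, j) \<in> F" "(Suc i, Suc j) \<in> F"
    using D(1) by (auto simp: E_def F_def)
  have same: "?w E xs = ?w D xs" "?w F xs = ?w D xs"
    if "(i, j) \<notin> set xs" "(Suc i, Suc j) \<notin> set xs" for xs
    using that by (auto simp: E_def F_def intro!: map_cong filter_cong)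
  have notin: "(i, j) \<notin> set as" "(Suc i, Suc j) \<notin> set as" "(i, j) \<notin> set ms"
     "(Suc i, Suc j) \<notin> set ms" "(i, j) \<notin> set ps" "(Suc i, Suc j) \<notin> set ps"
    using s by (auto simp: sorted_wrt_append)
  let ?s = "hecke_word (?w D as) (Some {1..d})"
  let ?s' = "Option.bind ?s (hecke ?p)"
  have r: "run d cs D = hecke_word (?w D ps) (hecke_word (?w D ms) ?s')"
    using D by (simp add: run_def 1 2 hecke_word_append)
  have "run d cs E = hecke_word (?w D ps) (Option.bind (hecke_word (?w D ms) ?s) (hecke ?p))"
    unfolding run_def 1 2 using EF by (simp add: hecke_word_append same notin p')
  then show "run d cs (insert (Suc i, Suc j) (D - {(i, j)})) = run d cs D"
    by (simp add: r hecke_word_commute[OF far] E_def[symmetric])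
  have "run d cs F = hecke_word (?w D ps) (Option.bind (hecke_word (?w D ms) ?s') (hecke ?p))"
    unfolding run_def 1 2 using EF by (simp add: hecke_word_append same notin p')
  \<comment> \<open>For a type II move the letter occurs twice; commuted next to its first
    occurrence, the second one is absorbed by idempotence.\<close>
  also have "Option.bind (hecke_word (?w D ms) ?s') (hecke ?p) = hecke_word (?w D ms) ?s'"
    unfolding hecke_word_commute[OF far] by (simp add: Option.bind_assoc hecke_idem)
  finally show "run d cs (insert (Suc i, Suc j) D) = run d cs D"
    by (simp add: r F_def)
qed

section \<open>Row reading in the lexicographic order of cells\<close>

definition cells :: "(nat \<Rightarrow> nat) \<Rightarrow> (nat \<times> nat) list" where
  "cells f = sorted_list_of_set (shape f)"

lemma cells_simps:
  assumes "ptn d f"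
  shows "set (cells f) = shape f" "sorted_wrt (<) (cells f)" "distinct (cells f)"
  using finite_shape[OF assms] by (simp_all add: cells_def)

lemma shape_upd:
  "1 \<le> i \<Longrightarrow> shape (f(i := Suc (f i))) = insert (i, Suc (f i)) (shape f)"
  by (auto simp: shape_def le_Suc_eq split: if_splits)

text \<open>All rows below \<open>i\<close> are empty, so the new cell is the lexicographically
  largest one.\<close>

lemma cells_upd:
  assumes f: "ptn d f" "ptn d (f(i := Suc (f i)))" and i: "1 \<le> i" "\<forall>k>i. f k = 0"
  shows "cells (f(i := Suc (f i))) = cells f @ [(i, Suc (f i))]"
proof -
  have "c < (i, Suc (f i))" if "c \<in> shape f" for c
  proof -
    obtain a b where c: "c = (a, b)" by force
    then have ab: "1 \<le> b" "b \<le> f a" using that by (auto simp: shape_def)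
    then have "a \<le> i" using i(2) by (metis le_zero_eq not_le not_one_le_zero order.trans)
    with ab show ?thesis by (cases "a = i") (auto simp: c)
  qed
  then have "sorted_wrt (<) (cells f @ [(i, Suc (f i))])"
    using cells_simps[OF f(1)] by (simp add: sorted_wrt_append)
  then show ?thesis
    using cells_simps[OF f(1)] cells_simps[OF f(2)] shape_upd[OF i(1), of f]
    by (intro strict_sorted_equal) (simp_all del: fun_upd_apply)
qed

text \<open>Builds a partition in reading order, so that each step appends one letter to the reading
  word. The cell removed in the proof is the last one of the lowest nonempty row.\<close>

lemma ptn_induct [consumes 1, case_names empty add]:
  assumes "ptn d f"
    and "\<And>f. ptn d f \<Longrightarrow> shape f = {} \<Longrightarrow> P f"
    and "\<And>f i. ptn d f \<Longrightarrow> ptn d (f(i := Suc (f i))) \<Longrightarrow> i \<in> {1..d} \<Longrightarrow>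
      \<forall>k>i. f k = 0 \<Longrightarrow> P f \<Longrightarrow> P (f(i := Suc (f i)))"
  shows "P f"
  using assms(1)
proof (induction "card (shape f)" arbitrary: f rule: less_induct)
  case less
  show ?case
  proof (cases "shape f = {}")
    case True
    then show ?thesis using less assms(2) by blast
  next
    case False
    let ?R = "fst ` shape f"
    have R: "finite ?R" "?R \<noteq> {}" using False finite_shape[OF less.prems] by auto
    define i where "i = Max ?R"
    have "i \<in> ?R" unfolding i_def using R by (rule Max_in)
    then have i: "1 \<le> i" "1 \<le> f i" "i \<le> d"
      using shape_row_le[OF less.prems] by (auto simp: shape_def)
    have below: "f k = 0" if "k > i" for k
    proof (rule ccontr)
      assume "f k \<noteq> 0"
      then have "k \<in> ?R" using that by (force simp: shape_def)
      then have "k \<le> i" unfolding i_def using R by simp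
      with that show False by simp
    qed
    define g where "g = f(i := f i - 1)"
    have f: "f = g(i := Suc (g i))" using i by (simp add: g_def)
    have "g (Suc k) \<le> g k" if "1 \<le> k" for k
      using that below[of "Suc k"] less.prems i by (auto simp: g_def ptn_def le_diff_conv intro: le_SucI)
    then have g: "ptn d g"
      using less.prems i by (auto simp: ptn_def g_def)
    have "(i, f i) \<notin> shape g" using i by (simp add: g_def shape_def)
    moreover have "shape f = insert (i, f i) (shape g)"
      using shape_upd[OF i(1), of g] unfolding f[symmetric] using i by (simp add: g_def)
    ultimately have "card (shape g) < card (shape f)"
      using finite_shape[OF g] by simp
    then have "P g" using less.hyps g by blast
    then show ?thesis
      using assms(3)[of g i] g less.prems i below unfolding f[symmetric] by (auto simp: g_def)
  qed
qed

lemma particles_empty: "shape f = {} \<Longrightarrow> particles d f = {1..d}"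
proof -
  assume "shape f = {}"
  then have f: "f i = 0" if "1 \<le> i" for i
    using that by (force simp: shape_def)
  have "position d f i = d - i + 1" if "i \<in> {1..d}" for i
    using that f by (simp add: position_def)
  then have "particles d f = (\<lambda>i. d - i + 1) ` {1..d}"
    by (auto simp: particles_def)
  also have "\<dots> = {1..d}"
  proof (rule set_eqI)
    fix q
    have "q = d - (d - q + 1) + 1 \<and> d - q + 1 \<in> {1..d}" if "q \<in> {1..d}"
      using that by auto
    then show "q \<in> (\<lambda>i. d - i + 1) ` {1..d} \<longleftrightarrow> q \<in> {1..d}" by (fastforce)
  qed
  finally show ?thesis .
qed

lemma position_upd: "i \<in> {1..d} \<Longrightarrow> position d (f(i := Suc (f i))) i = Suc (position d f i)"
  by (auto simp: position_def Suc_diff_le)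

lemma particles_upd:
  assumes f: "ptn d f" and i: "i \<in> {1..d}"
  shows "particles d (f(i := Suc (f i)))
    = insert (Suc (position d f i)) (particles d f - {position d f i})"
proof -
  have 1: "{1..d} = insert i ({1..d} - {i})" using i by auto
  note 2 = position_upd[OF i, of f]
  have 3: "position d (f(i := Suc (f i))) ` ({1..d} - {i}) = position d f ` ({1..d} - {i})"
    by (intro image_cong) (auto simp: position_def)
  have 4: "position d f ` ({1..d} - {i}) = particles d f - {position d f i}"
    unfolding particles_def
    using inj_on_image_set_diff[OF inj_on_position[OF f], of "{1..d}" "{i}"] i by auto
  show ?thesis
    unfolding particles_def by (subst 1) (simp only: image_insert 2 3 4 particles_def)
qed

lemma position_in: "i \<in> {1..d} \<Longrightarrow> position d f i \<in> particles d f"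
  by (simp add: particles_def)

text \<open>If that place were taken, two rows of the enlarged partition would share a
  position.\<close>

lemma Suc_position_notin:
  assumes "ptn d f" "ptn d (f(i := Suc (f i)))" "i \<in> {1..d}"
  shows "Suc (position d f i) \<notin> particles d f"
proof
  let ?f = "f(i := Suc (f i))"
  assume "Suc (position d f i) \<in> particles d f"
  then obtain k where k: "k \<in> {1..d}" "position d f k = Suc (position d f i)"
    by (auto simp: particles_def)
  then have "k \<noteq> i" by auto
  then have "position d ?f k = position d ?f i"
    using k assms(3) by (simp add: position_upd position_def[of _ "f(i := Suc (f i))" k]) (simp add: position_def)
  then show False
    using inj_on_position[OF assms(2)] k(1) assms(3) \<open>k \<noteq> i\<close> by (auto dest: inj_onD)
qed

text \<open>The content of the new cell is the position of the particle of its row, and the place to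
  its right is free.\<close>

lemma hecke_particles:
  assumes "ptn d f" "ptn d (f(i := Suc (f i)))" "i \<in> {1..d}"
  shows "hecke (content d (i, Suc (f i))) (particles d f) = Some (particles d (f(i := Suc (f i))))"
proof -
  have "content d (i, Suc (f i)) = position d f i"
    using assms(3) by (auto simp: content_def position_def)
  then show ?thesis
    using position_in[OF assms(3)] Suc_position_notin[OF assms] particles_upd[OF assms(1,3)]
    by (simp add: hecke_def)
qed

lemma run_shape_self:
  assumes "ptn d f" shows "run d (cells f) (shape f) = Some (particles d f)"
  using assms
proof (induction rule: ptn_induct)
  case (empty f)
  then show ?case by (simp add: run_def cells_def particles_empty)
next
  case (add f i)
  have "run d (cells f) (shape (f(i := Suc (f i)))) = run d (cells f) (shape f)"
    using cells_simps(1)[OF add(1)] add(3) shape_upd[of i f] by (intro run_cong) (auto simp: shape_def)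
  then show ?case
    using add cells_upd[OF add(1,2)] hecke_particles[OF add(1-3)] shape_upd[of i f]
    by (simp add: run_snoc del: fun_upd_apply)
qed

text \<open>Filtering keeps the order, so the cells of \<open>g\<close> inside the reading of
  \<open>f\<close> form the reading of \<open>g\<close> itself.\<close>

lemma run_shape:
  assumes f: "ptn d f" and g: "ptn d g" and sub: "shape g \<subseteq> shape f"
  shows "run d (cells f) (shape g) = Some (particles d g)"
proof -
  have "filter (\<lambda>c. c \<in> shape g) (cells f) = cells g"
    using cells_simps[OF f] cells_simps[OF g] sub
    by (intro strict_sorted_equal) (auto simp: sorted_wrt_filter)
  moreover have "filter (\<lambda>c. c \<in> shape g) (cells g) = cells g"
    using cells_simps(1)[OF g] by (simp add: filter_id_conv)
  ultimately show ?thesis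
    using run_shape_self[OF g] by (simp add: run_def)
qed

section \<open>Excited diagrams as Hecke words\<close>

text \<open>A subset of the shape that admits no backward excited move and is not annihilated
  by the Hecke action is a diagram: the first cell of it that violates this would meet a state
  in which both or none of the two affected positions are occupied.\<close>

lemma run_straight:
  assumes f: "ptn d f" and D: "D \<subseteq> shape f"
    and straight: "\<And>i j. 1 \<le> i \<Longrightarrow> 1 \<le> j \<Longrightarrow> (Suc i, Suc j) \<in> D \<Longrightarrow> (Suc i, j) \<in> D \<or> (i, Suc j) \<in> D"
    and run: "run d (cells f) D = Some s"
  shows "\<exists>g. ptn d g \<and> D = shape g \<and> s = particles d g"
proof -
  \<comment> \<open>Induction over prefixes of the reading: the part of \<open>D\<close> read so far
    is always a diagram, and the state is its configuration.\<close>
  have "\<exists>g. ptn d g \<and> D \<inter> set pre = shape g \<and> s = particles d g"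
    if "cells f = pre @ post" "run d pre D = Some s" for pre post s
    using that
  proof (induction pre arbitrary: post s rule: rev_induct)
    case Nil
    have "ptn d (\<lambda>_. 0)" "shape (\<lambda>_. 0) = {}" by (auto simp: ptn_def shape_def)
    then show ?case
      using Nil particles_empty[of "\<lambda>_. 0" d] by (intro exI[of _ "\<lambda>_. 0"]) (simp add: run_def)
  next
    case (snoc c pre)
    have split: "cells f = pre @ (c # post)" using snoc.prems by simp
    show ?case
    proof (cases "c \<in> D")
      case False
      then show ?thesis using snoc.IH[OF split] snoc.prems by (simp add: run_snoc)
    next
      case True
      obtain i j where c: "c = (i, j)" by force
      from True snoc.prems(2) obtain t where t: "run d pre D = Some t" "hecke (content d c) t = Some s"
        by (auto simp: run_snoc bind_eq_Some_conv)
      from snoc.IH[OF split t(1)] obtain g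
        where g: "ptn d g" "D \<inter> set pre = shape g" "t = particles d g" by blast
      have "c \<in> shape f" using True D by blast
      then have ij: "1 \<le> i" "1 \<le> j" "j \<le> f i" "i \<le> d"
        using shape_row_le[OF f] by (auto simp: c shape_def)
      then have id: "i \<in> {1..d}" by simp
      have sorted: "sorted_wrt (<) (pre @ (c # post))"
        using cells_simps(2)[OF f] unfolding split .
      have before: "(a, b) \<in> set pre \<longleftrightarrow> (a, b) \<in> shape f \<and> (a < i \<or> a = i \<and> b < j)" for a b
      proof -
        have "(a, b) \<in> set pre \<longleftrightarrow> (a, b) \<in> shape f \<and> (a, b) < c"
          unfolding cells_simps(1)[OF f, symmetric] split using sorted
          by (auto simp: sorted_wrt_append)
        also have "(a, b) < c \<longleftrightarrow> a < i \<or> a = i \<and> b < j"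
          by (auto simp: c)
        finally show ?thesis .
      qed
      have in_D: "(a, b) \<in> D \<longleftrightarrow> b \<le> g a"
        if "1 \<le> a" "1 \<le> b" "a < i \<or> a = i \<and> b < j" for a b
      proof -
        have "(a, b) \<in> D \<longleftrightarrow> (a, b) \<in> D \<inter> set pre" using before that D by auto
        also have "\<dots> \<longleftrightarrow> b \<le> g a" unfolding g(2) using that by (simp add: shape_def)
        finally show ?thesis .
      qed
      have out: "(a, b) \<notin> shape g" if "\<not> (a < i \<or> a = i \<and> b < j)" for a b
        using before[of a b] that unfolding g(2)[symmetric] by blast
      have gi: "g i < j"
        using out[of i j] ij by (simp add: shape_def)
      let ?p = "content d c"
      have hk: "(?p \<in> t \<and> Suc ?p \<notin> t) \<or> (?p \<notin> t \<and> Suc ?p \<in> t)"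
        using t(2) by (auto simp: hecke_def split: if_splits)
      have low: "position d g k < ?p" if "k \<in> {1..d}" "i \<le> k" "Suc (g i) < j" for k
        using that ptn_mono[OF g(1), of i k] ij by (auto simp: position_def content_def c)
      have high: "Suc ?p < position d g k" if "k \<in> {1..d}" "k < i" "j \<le> g (i - 1)" for k
      proof -
        have "k \<le> i - 1" "1 \<le> k" using that by auto
        then have "j \<le> g k" using ptn_mono[OF g(1), of k "i - 1"] that(3) by linarith
        then show ?thesis using that ij unfolding position_def content_def c fst_conv snd_conv by linarith
      qed
      have ex: "\<exists>k\<in>{1..d}. position d g k = ?p \<or> position d g k = Suc ?p"
        using hk by (auto simp: g(3) particles_def)
      \<comment> \<open>If row \<open>i\<close> ended earlier, its particle and all lower ones would
        lie left of \<open>?p\<close>. For \<open>i > 1\<close> the cell \<open>(i, j - 1)\<close>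
        would be missing from \<open>D\<close>, so straightness would put \<open>(i - 1, j)\<close>
        into \<open>D\<close> and all higher particles right of \<open>Suc ?p\<close>. Both
        positions would then be empty.\<close>
      have row: "Suc (g i) = j"
      proof (rule ccontr)
        assume "Suc (g i) \<noteq> j"
        then have lt: "Suc (g i) < j" using gi by simp
        show False
        proof (cases "i = 1")
          case True
          then show False using ex low lt by force
        next
          case False
          define a b where "a = i - 1" and "b = j - 1"
          have ab: "i = Suc a" "j = Suc b" "1 \<le> a" "1 \<le> b"
            using False ij lt by (auto simp: a_def b_def)
          have "(i, b) \<notin> D" using in_D[of i b] lt ab ij by simp
          then have "(a, j) \<in> D"
            using straight[of a b] True ab by (auto simp: c)
          then have "j \<le> g (i - 1)" using in_D[of a j] ab ij by simp
          then show False using ex low high lt by (metis Suc_lessD less_irrefl not_le)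
        qed
      qed
      have p: "?p = position d g i" using row ij by (auto simp: content_def position_def c)
      have "?p \<in> t" unfolding p g(3) by (rule position_in[OF id])
      then have p_free: "Suc ?p \<notin> t" using hk by blast
      \<comment> \<open>Otherwise rows \<open>i - 1\<close> and \<open>i\<close> of \<open>g\<close>
        have equal length, and the particle of row \<open>i - 1\<close> blocks the one at
        \<open>?p\<close>.\<close>
      have col: "j \<le> g (i - 1)" if "i \<noteq> 1"
      proof (rule ccontr)
        assume "\<not> j \<le> g (i - 1)"
        then have "g (i - 1) = g i"
          using row ptn_mono[OF g(1), of "i - 1" i] ij that by fastforce
        then have "position d g (i - 1) = Suc ?p"
          using ij that unfolding p by (auto simp: position_def)
        moreover have "position d g (i - 1) \<in> t"
          unfolding g(3) using ij that by (intro position_in) auto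
        ultimately show False using p_free by simp
      qed
      let ?g = "g(i := Suc (g i))"
      have g': "ptn d ?g"
        unfolding ptn_def
      proof (intro conjI allI impI)
        fix k :: nat assume "1 \<le> k"
        then show "?g (Suc k) \<le> ?g k"
          using ptn_mono[OF g(1), of k "Suc k"] col row by (auto simp: le_SucI)
      next
        fix k assume "d < k"
        then show "?g k = 0" using g(1) ij by (auto simp: ptn_def)
      qed
      have "D \<inter> set (pre @ [c]) = shape ?g"
        using True g(2) row shape_upd[OF ij(1), of g] by (auto simp: c simp del: fun_upd_apply)
      moreover have "s = particles d ?g"
        using hecke_particles[OF g(1) g' id] t(2) row by (simp add: c g(3))
      ultimately show ?thesis using g' by blast
    qed
  qed
  from this[of "cells f" "[]" s] show ?thesis
    using run D cells_simps(1)[OF f] by (simp add: Int_absorb2)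
qed

text \<open>Undo excited moves as long as possible. Each backward move keeps the run and lowers the
  sum of \<open>i + j\<close> over \<open>D\<close>; a set without backward moves is a diagram by
  \<open>run_straight\<close>. The diagram is known only at the end, hence the inner quantifier over
  \<open>mu\<close>.\<close>

lemma run_Some:
  assumes f: "ptn d f" and la: "diagram la = shape f"
    and D: "D \<subseteq> shape f" and run: "run d (cells f) D = Some s"
  shows "\<exists>g. ptn d g \<and> shape g \<subseteq> shape f \<and> s = particles d g \<and>
    (\<forall>mu. diagram mu = shape g \<longrightarrow> D \<in> gen_excited la mu)"
  using D run
proof (induction "\<Sum>(i, j)\<in>D. i + j" arbitrary: D rule: less_induct)
  case less
  let ?m = "\<lambda>D. \<Sum>(i, j)\<in>D. i + j :: nat"
  have fin: "finite D" using less.prems(1) finite_shape[OF f] finite_subset by blast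
  show ?case
  proof (cases "\<exists>i j. 1 \<le> i \<and> 1 \<le> j \<and> (Suc i, Suc j) \<in> D \<and> (Suc i, j) \<notin> D \<and> (i, Suc j) \<notin> D")
    case False
    then obtain g where "ptn d g" "D = shape g" "s = particles d g"
      using run_straight[OF f less.prems(1) _ less.prems(2)] by blast
    then show ?thesis using less.prems(1) by (metis gen_excited.init)
  next
    case True
    then obtain i j where ij: "1 \<le> i" "1 \<le> j" "(Suc i, Suc j) \<in> D" "(Suc i, j) \<notin> D" "(i, Suc j) \<notin> D"
      by blast
    \<comment> \<open>The set before the move: of type II if \<open>(i, j)\<close> already lies in
      \<open>D\<close>, of type I otherwise.\<close>
    define E where "E = insert (i, j) (D - {(Suc i, Suc j)})"
    have f_col: "f (Suc i) \<le> f i" using f ij(1) by (simp add: ptn_def)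
    have corner: "(Suc i, Suc j) \<in> shape f" using ij(3) less.prems(1) by blast
    then have cells: "(i, j) \<in> shape f" "(Suc i, j) \<in> shape f" "(i, Suc j) \<in> shape f"
      using ij f_col by (auto simp: shape_def)
    have i_less: "i < d" using shape_row_le[OF f corner] by simp
    have E: "E \<subseteq> shape f" using less.prems(1) cells by (auto simp: E_def)
    have act: "active la E (i, j)"
      using ij cells corner by (auto simp: active_def la E_def)
    have "?m D = Suc i + Suc j + ?m (D - {(Suc i, Suc j)})"
      using fin ij(3) by (subst sum.remove[of _ "(Suc i, Suc j)"]) auto
    moreover have "?m E \<le> i + j + ?m (D - {(Suc i, Suc j)})"
      using fin unfolding E_def by (subst sum.insert_if) auto
    ultimately have "?m E < ?m D" by simp
    moreover have "run d (cells f) E = Some s \<and>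
       (\<forall>mu. E \<in> gen_excited la mu \<longrightarrow> D \<in> gen_excited la mu)"
    proof (cases "(i, j) \<in> D")
      case True
      then have D: "insert (Suc i, Suc j) E = D" using ij by (auto simp: E_def)
      have "run d (cells f) (insert (Suc i, Suc j) E) = run d (cells f) E"
        using cells corner cells_simps[OF f] i_less ij
        by (intro run_excited(2)) (auto simp: E_def)
      then show ?thesis
        unfolding D using less.prems(2) gen_excited.typeII[OF _ act] D by auto
    next
      case False
      then have D: "insert (Suc i, Suc j) (E - {(i, j)}) = D" using ij by (auto simp: E_def)
      have "run d (cells f) (insert (Suc i, Suc j) (E - {(i, j)})) = run d (cells f) E"
        using cells corner cells_simps[OF f] i_less ij
        by (intro run_excited(1)) (auto simp: E_def)
      then show ?thesis
        unfolding D using less.prems(2) gen_excited.typeI[OF _ act] D by auto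
    qed
    ultimately show ?thesis using less.hyps[of E] E by blast
  qed
qed

lemma gen_excited_run:
  assumes f: "ptn d f" and la: "diagram la = shape f"
    and g: "ptn d g" and mu: "diagram mu = shape g" and sub: "shape g \<subseteq> shape f"
    and D: "D \<in> gen_excited la mu"
  shows "D \<subseteq> shape f \<and> run d (cells f) D = Some (particles d g)"
  using D
proof induction
  case init
  then show ?case using sub run_shape[OF f g sub] by (simp add: mu)
next
  case (typeI S i j)
  then have *: "(i, j) \<in> S" "(Suc i, Suc j) \<in> shape f" "(Suc i, j) \<notin> S" "(i, Suc j) \<notin> S" "(Suc i, Suc j) \<notin> S"
    by (auto simp: active_def la)
  then have "i < d" "(i, j) \<in> shape f" using shape_row_le[OF f *(2)] typeI by auto
  then show ?case
    using * typeI run_excited(1)[of "cells f" i j d S] cells_simps[OF f] by auto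
next
  case (typeII S i j)
  then have *: "(i, j) \<in> S" "(Suc i, Suc j) \<in> shape f" "(Suc i, j) \<notin> S" "(i, Suc j) \<notin> S" "(Suc i, Suc j) \<notin> S"
    by (auto simp: active_def la)
  then have "i < d" "(i, j) \<in> shape f" using shape_row_le[OF f *(2)] typeII by auto
  then show ?case
    using * typeII run_excited(2)[of "cells f" i j d S] cells_simps[OF f] by auto
qed

text \<open>Undoing moves from a set with the right run ends in some diagram with the particles of
  \<open>g\<close>, and the particles determine the diagram.\<close>

lemma gen_excited_eq:
  assumes f: "ptn d f" and la: "diagram la = shape f"
    and g: "ptn d g" and mu: "diagram mu = shape g" and sub: "shape g \<subseteq> shape f"
  shows "gen_excited la mu = {D. D \<subseteq> shape f \<and> run d (cells f) D = Some (particles d g)}"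
proof (intro equalityI subsetI)
  fix D assume "D \<in> {D. D \<subseteq> shape f \<and> run d (cells f) D = Some (particles d g)}"
  then have D: "D \<subseteq> shape f" "run d (cells f) D = Some (particles d g)" by auto
  obtain h where h: "ptn d h" "particles d g = particles d h"
      "\<forall>mu. diagram mu = shape h \<longrightarrow> D \<in> gen_excited la mu"
    using run_Some[OF f la D] by metis
  then show "D \<in> gen_excited la mu" using particles_inject[OF g h(1,2)] mu by simp
qed (use gen_excited_run[OF assms] in blast)

section \<open>The recurrence for the excited sum\<close>

text \<open>Expanding the product of the operators \<open>1 + u c * T\<close> over the cells
  \<open>c\<close>, with \<open>T\<close> the generator at the content of \<open>c\<close>, this is
  the coefficient of \<open>s\<close> when it is applied to the empty partition.\<close>

definition state_sum :: "nat \<Rightarrow> (nat \<times> nat) list \<Rightarrow> (nat \<times> nat \<Rightarrow> 'a::comm_semiring_1) \<Rightarrow> nat set \<Rightarrow> 'a" where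
  "state_sum d cs u s = (\<Sum>D | D \<subseteq> set cs \<and> run d cs D = Some s. prod u D)"

lemma state_sum_Nil: "state_sum d [] u s = (if s = {1..d} then 1 else 0)"
proof -
  have "{D. D \<subseteq> set [] \<and> run d [] D = Some s} = (if s = {1..d} then {{}} else {})"
    by (auto simp: run_def)
  then show ?thesis unfolding state_sum_def by simp
qed

lemma state_sum_cong:
  "(\<And>c. c \<in> set cs \<Longrightarrow> u c = u' c) \<Longrightarrow> state_sum d cs u s = state_sum d cs u' s"
  unfolding state_sum_def by (intro sum.cong prod.cong) auto

text \<open>Split the subsets by whether they contain \<open>x\<close>. Those that do apply one
  further generator at the end, so the earlier cells must reach a preimage of
  \<open>s\<close>.\<close>

lemma state_sum_snoc:
  assumes "x \<notin> set cs" "content d x = p"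
  shows "state_sum d (cs @ [x]) u s = state_sum d cs u s + u x * hecke_dual p (state_sum d cs u) s"
proof -
  let ?R = "\<lambda>t. {D. D \<subseteq> set cs \<and> run d cs D = Some t}"
  let ?B = "{D. D \<subseteq> set cs \<and> Option.bind (run d cs D) (hecke p) = Some s}"
  have fin: "finite {D. D \<subseteq> set cs \<and> P D}" for P
    by (rule finite_subset[of _ "Pow (set cs)"]) auto
  have ins: "run d (cs @ [x]) (insert x D) = Option.bind (run d cs D) (hecke p)" for D
  proof -
    have "run d cs (insert x D) = run d cs D" using assms(1) by (intro run_cong) auto
    then show ?thesis using assms(2) by (simp add: run_snoc)
  qed
  have no: "run d (cs @ [x]) D = run d cs D" if "D \<subseteq> set cs" for D
    using assms that by (auto simp: run_snoc)
  have split: "{D. D \<subseteq> set (cs @ [x]) \<and> run d (cs @ [x]) D = Some s} = ?R s \<union> insert x ` ?B"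
  proof (intro equalityI subsetI)
    fix D assume D: "D \<in> {D. D \<subseteq> set (cs @ [x]) \<and> run d (cs @ [x]) D = Some s}"
    show "D \<in> ?R s \<union> insert x ` ?B"
    proof (cases "x \<in> D")
      case True
      then have "D = insert x (D - {x})" "D - {x} \<subseteq> set cs" using D by auto
      moreover have "D - {x} \<in> ?B" using D calculation ins[of "D - {x}"] by auto
      ultimately show ?thesis by blast
    next
      case False
      then have "D \<subseteq> set cs" using D by auto
      then show ?thesis using D no by auto
    qed
  next
    fix D assume "D \<in> ?R s \<union> insert x ` ?B"
    then show "D \<in> {D. D \<subseteq> set (cs @ [x]) \<and> run d (cs @ [x]) D = Some s}"
      using ins no by auto
  qed
  have inj: "inj_on (insert x) ?B"
    using assms(1) by (auto simp: inj_on_def)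
  have "state_sum d (cs @ [x]) u s = sum (prod u) (?R s) + sum (prod u) (insert x ` ?B)"
    unfolding state_sum_def split using assms(1) fin by (intro sum.union_disjoint) auto
  also have "sum (prod u) (insert x ` ?B) = (\<Sum>D\<in>?B. u x * prod u D)"
    unfolding sum.reindex[OF inj] comp_def
  proof (rule sum.cong[OF refl])
    fix D assume "D \<in> ?B"
    then have "x \<notin> D" "finite D" using assms(1) finite_subset by auto
    then show "prod u (insert x D) = u x * prod u D" by simp
  qed
  also have "\<dots> = u x * sum (prod u) ?B" by (simp add: sum_distrib_left)
  also have "sum (prod u) ?B = hecke_dual p (state_sum d cs u) s"
  proof (cases "p \<notin> s \<and> Suc p \<in> s")
    case True
    let ?s = "insert p (s - {Suc p})"
    have "hecke p t = Some s \<longleftrightarrow> t = s \<or> t = ?s" for t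
      using True by (auto simp: hecke_def split: if_splits)
    then have "?B = ?R s \<union> ?R ?s" by (auto simp: bind_eq_Some_conv)
    moreover have "?R s \<inter> ?R ?s = {}" using True by auto
    ultimately have "sum (prod u) ?B = sum (prod u) (?R s) + sum (prod u) (?R ?s)"
      using fin by (simp add: sum.union_disjoint)
    then show ?thesis using True by (simp add: hecke_dual_def state_sum_def)
  next
    case False
    then have "hecke p t \<noteq> Some s" for t by (auto simp: hecke_def split: if_splits)
    then have "?B = {}" by (auto simp: bind_eq_Some_conv)
    then show ?thesis using False by (simp only: hecke_dual_def) simp
  qed
  finally show ?thesis by (simp add: state_sum_def)
qed

section \<open>Cell weights and their change when a cell is added\<close>

definition col_length :: "nat \<Rightarrow> (nat \<Rightarrow> nat) \<Rightarrow> nat \<Rightarrow> nat" where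
  "col_length d f j = card {i \<in> {1..d}. j \<le> f i}"

text \<open>Ratio of \<open>z\<close> at the hole of the column to \<open>z\<close> at the particle
  of the row, minus 1. For \<open>z q = 1 + \<beta> * y q\<close> it is \<beta> divided by the
  factor of the cell in the theorem.\<close>

definition weight :: "nat \<Rightarrow> (nat \<Rightarrow> nat) \<Rightarrow> (nat \<Rightarrow> 'a::field) \<Rightarrow> nat \<times> nat \<Rightarrow> 'a" where
  "weight d f z c = z (d + snd c - col_length d f (snd c)) / z (position d f (fst c)) - 1"

text \<open>The column of the new cell has length \<open>i\<close>, so its hole is the position that
  the particle of row \<open>i\<close> has just left.\<close>

lemma weight_last:
  assumes f: "ptn d f" and f': "ptn d (f(i := Suc (f i)))"
    and i: "i \<in> {1..d}" "\<forall>k>i. f k = 0"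
  shows "weight d (f(i := Suc (f i))) z (i, Suc (f i))
    = z (position d f i) / z (Suc (position d f i)) - 1"
proof -
  let ?f = "f(i := Suc (f i))"
  have "{k \<in> {1..d}. Suc (f i) \<le> ?f k} = {1..i}"
  proof (rule set_eqI)
    fix k
    have "Suc (f i) \<le> ?f k" if "1 \<le> k" "k \<le> i"
      using ptn_mono[OF f' that] by simp
    moreover have "\<not> Suc (f i) \<le> ?f k" if "i < k" using i that by simp
    ultimately show "k \<in> {k \<in> {1..d}. Suc (f i) \<le> ?f k} \<longleftrightarrow> k \<in> {1..i}"
      using i(1) by (cases "k \<le> i") auto
  qed
  then have "col_length d ?f (Suc (f i)) = i" by (simp add: col_length_def del: fun_upd_apply)
  moreover have "d + Suc (f i) - i = position d f i" using i by (auto simp: position_def)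
  ultimately show ?thesis
    using position_upd[OF i(1), of f] by (simp add: weight_def del: fun_upd_apply)
qed

text \<open>Adding the last cell lets the particle of row \<open>i\<close> and the hole of the cell's column
  exchange positions, so the weights of the smaller shape are those for the swapped variables.\<close>

lemma weight_swap:
  fixes z :: "nat \<Rightarrow> 'a::field"
  assumes f: "ptn d f" and f': "ptn d (f(i := Suc (f i)))"
    and i: "i \<in> {1..d}" "\<forall>k>i. f k = 0" and c: "c \<in> shape f"
    and p: "p = position d f i"
  shows "weight d (f(i := Suc (f i))) z c = weight d f (z(p := z (Suc p), Suc p := z p)) c"
proof -
  let ?f = "f(i := Suc (f i))"
  let ?z = "z(p := z (Suc p), Suc p := z p)"
  obtain a b where ab: "c = (a, b)" by force
  with c have cell: "1 \<le> a" "1 \<le> b" "b \<le> f a" by (auto simp: shape_def)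
  then have a: "a \<le> i" using i(2) by (metis le_zero_eq not_le not_one_le_zero order.trans)
  have ad: "a \<in> {1..d}" using a cell i by simp
  have row: "z (position d ?f a) = ?z (position d f a)"
  proof (cases "a = i")
    case True
    then show ?thesis using position_upd[OF i(1), of f] by (simp add: p del: fun_upd_apply) simp
  next
    case False
    then have "position d ?f a = position d f a" by (simp add: position_def)
    moreover have "position d f a \<noteq> p"
      unfolding p using False inj_on_position[OF f] ad i(1) by (auto dest: inj_onD)
    moreover have "position d f a \<noteq> Suc p"
      unfolding p using Suc_position_notin[OF f f' i(1)] position_in[OF ad, of f] by metis
    ultimately show ?thesis by simp
  qed
  have fi: "Suc (f i) \<le> f k" if "1 \<le> k" "k < i" for k
    using ptn_mono[OF f', of k i] that by simp
  have p': "p = d + Suc (f i) - i" using i by (auto simp: p position_def)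
  have col: "z (d + b - col_length d ?f b) = ?z (d + b - col_length d f b)"
  proof (cases "b = Suc (f i)")
    case True
    have "{k \<in> {1..d}. b \<le> f k} = {1..<i}"
    proof (rule set_eqI)
      fix k
      show "k \<in> {k \<in> {1..d}. b \<le> f k} \<longleftrightarrow> k \<in> {1..<i}"
        using i fi[of k] True by (cases k i rule: linorder_cases) auto
    qed
    moreover have "{k \<in> {1..d}. b \<le> ?f k} = {1..i}"
    proof (rule set_eqI)
      fix k
      show "k \<in> {k \<in> {1..d}. b \<le> ?f k} \<longleftrightarrow> k \<in> {1..i}"
        using i fi[of k] True by (cases k i rule: linorder_cases) auto
    qed
    ultimately have "col_length d f b = i - 1" "col_length d ?f b = i"
      by (simp_all add: col_length_def del: fun_upd_apply)
    then have "d + b - col_length d ?f b = p" "d + b - col_length d f b = Suc p"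
      using True i(1) by (auto simp: p' simp del: fun_upd_apply)
    then show ?thesis by simp
  next
    case False
    have same: "col_length d ?f b = col_length d f b"
      unfolding col_length_def using False by (intro arg_cong[where f = card]) auto
    \<comment> \<open>Columns up to \<open>f i\<close> have length at least \<open>i\<close>, which
      puts their holes left of \<open>p\<close>; columns after that of the new cell have length
      below \<open>i\<close>, which puts theirs right of \<open>Suc p\<close>.\<close>
    have "d + b - col_length d f b < p \<or> Suc p < d + b - col_length d f b"
    proof (cases "b \<le> f i")
      case True
      have "{1..i} \<subseteq> {k \<in> {1..d}. b \<le> f k}"
        using True i(1) ptn_mono[OF f] by (auto intro: le_trans)
      from card_mono[OF _ this] have "i \<le> col_length d f b" by (simp add: col_length_def)
      then have "d + b - col_length d f b < p" using True i(1) by (auto simp: p')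
      then show ?thesis ..
    next
      case b: False
      have "{k \<in> {1..d}. b \<le> f k} \<subseteq> {1..<i}"
      proof
        fix k assume k: "k \<in> {k \<in> {1..d}. b \<le> f k}"
        then show "k \<in> {1..<i}"
          using i b cell by (cases k i rule: linorder_cases) auto
      qed
      from card_mono[OF _ this] have "col_length d f b \<le> i - 1" by (simp add: col_length_def)
      then have "Suc p < d + b - col_length d f b" using b False i(1) by (auto simp: p')
      then show ?thesis ..
    qed
    then show ?thesis unfolding same by auto
  qed
  show ?thesis unfolding weight_def ab by (simp add: row col del: fun_upd_apply)
qed

text \<open>Induction by cells with \<open>z\<close> arbitrary, because the hypothesis is applied to
  the swapped variables. In the base case only the empty move can reach
  \<open>{1..d}\<close>.\<close>

lemma state_sum_recurrence:
  fixes z :: "nat \<Rightarrow> 'a::field"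
  assumes "ptn d f" and "\<And>q. q \<in> particles d f \<Longrightarrow> z q \<noteq> 0"
    and "finite s" "0 \<notin> s"
  shows "prod z s * state_sum d (cells f) (weight d f z) s
    = prod z (particles d f) * up_sum (state_sum d (cells f) (weight d f z)) s"
  using assms
proof (induction arbitrary: z s rule: ptn_induct)
  case (empty f)
  let ?v = "state_sum d (cells f) (weight d f z)"
  have v: "?v t = (if t = {1..d} then 1 else 0)" for t
    using empty(2) by (simp add: cells_def state_sum_Nil)
  have u: "up_sum ?v s = (\<Sum>Q\<in>{{}}. ?v (mv s Q))"
    unfolding up_sum_def
  proof (rule sum.mono_neutral_right)
    show "finite (Pow (addable s))" using finite_addable[OF empty(4)] by simp
    show "\<forall>Q\<in>Pow (addable s) - {{}}. ?v (mv s Q) = 0"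
      using mv_eq_interval[OF empty(4,5)] by (auto simp: v)
  qed simp
  have "prod z s * ?v s = prod z (particles d f) * up_sum ?v s"
    unfolding u by (simp add: v particles_empty[OF empty(2)])
  then show ?case .
next
  case (add f i)
  define g where "g = f(i := Suc (f i))"
  define p where "p = position d f i"
  let ?z = "z(p := z (Suc p), Suc p := z p)"
  note f = add.hyps(1) and i = add.hyps(3,4)
  have g: "ptn d g" using add.hyps(2) by (simp add: g_def)
  have pg: "particles d g = insert (Suc p) (particles d f - {p})"
    using particles_upd[OF f i(1)] by (simp add: g_def p_def)
  have pin: "p \<in> particles d f" "Suc p \<notin> particles d f"
    using position_in[OF i(1)] Suc_position_notin[OF f add.hyps(2) i(1)] by (simp_all add: p_def)
  have z_eq: "?z q = z q" if "q \<in> particles d f - {p}" for q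
    using that pin by auto
  have fin: "finite (particles d f)" by (simp add: particles_def)
  have nz: "z q \<noteq> 0" if "q \<in> particles d g" for q
    using add.prems(1) that unfolding g_def by blast
  have nz': "?z q \<noteq> 0" if "q \<in> particles d f" for q
    using nz that pin by (cases "q = p") (auto simp: pg)
  \<comment> \<open>The particle at \<open>p\<close> carries the swapped value
    \<open>z (Suc p)\<close>, which is what it carries unswapped after its move. So the factor on
    the right of the recurrence stays the same.\<close>
  have "prod ?z (particles d f) = z (Suc p) * prod ?z (particles d f - {p})"
    using fin pin by (simp add: prod.remove)
  also have "prod ?z (particles d f - {p}) = prod z (particles d f - {p})"
    using z_eq by (intro prod.cong) auto
  also have "z (Suc p) * \<dots> = prod z (particles d g)"
    using fin pin by (simp add: pg)
  finally have omega: "prod ?z (particles d f) = prod z (particles d g)" .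
  define v where "v = state_sum d (cells f) (weight d f ?z)"
  have cells: "cells g = cells f @ [(i, Suc (f i))]"
    unfolding g_def using cells_upd[OF f add.hyps(2)] i by simp
  have sw: "state_sum d (cells f) (weight d g z) = v"
    unfolding v_def g_def
    using weight_swap[OF f add.hyps(2) i _ p_def] cells_simps(1)[OF f]
    by (intro ext state_sum_cong) (simp del: fun_upd_apply)
  have v': "state_sum d (cells g) (weight d g z) t
      = v t + (z p / z (Suc p) - 1) * hecke_dual p v t" for t
  proof -
    have "(i, Suc (f i)) \<notin> set (cells f)" using cells_simps(1)[OF f] by (simp add: shape_def)
    moreover have "content d (i, Suc (f i)) = p"
      using i by (auto simp: p_def content_def position_def)
    moreover have "weight d g z (i, Suc (f i)) = z p / z (Suc p) - 1"
      unfolding g_def p_def by (rule weight_last[OF f add.hyps(2) i])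
    ultimately show ?thesis
      unfolding cells by (simp add: state_sum_snoc sw)
  qed
  have "prod z s * state_sum d (cells g) (weight d g z) s
    = prod z (particles d g) * up_sum (state_sum d (cells g) (weight d g z)) s"
  proof (rule up_sum_step[where p = p and v = v])
    show "prod ?z t * v t = prod z (particles d g) * up_sum v t" if "finite t" "0 \<notin> t" for t
      unfolding v_def omega[symmetric] using nz' that by (rule add.IH)
    show "0 < p" by (simp add: p_def position_def)
    show "z (Suc p) \<noteq> 0" using nz by (simp add: pg)
  qed (use add.prems v' in auto)
  then show ?case by (simp add: g_def del: fun_upd_apply)
qed

section \<open>Removing the first layer of a tableau\<close>

text \<open>Row 1 is treated apart because \<open>g 0\<close> is arbitrary.\<close>

definition addable_rows :: "nat \<Rightarrow> (nat \<Rightarrow> nat) \<Rightarrow> nat set" where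
  "addable_rows d g = {i \<in> {1..d}. i = 1 \<or> g i < g (i - 1)}"

definition add_boxes :: "(nat \<Rightarrow> nat) \<Rightarrow> nat set \<Rightarrow> nat \<Rightarrow> nat" where
  "add_boxes g I i = (if i \<in> I then Suc (g i) else g i)"

lemma ptn_add_boxes:
  assumes g: "ptn d g" and I: "I \<subseteq> addable_rows d g"
  shows "ptn d (add_boxes g I)"
  unfolding ptn_def
proof (intro conjI allI impI)
  fix i :: nat assume i: "1 \<le> i"
  have "g (Suc i) < g i" if "Suc i \<in> I"
    using that I i by (auto simp: addable_rows_def)
  moreover have "g (Suc i) \<le> g i" using g i by (simp add: ptn_def)
  ultimately show "add_boxes g I (Suc i) \<le> add_boxes g I i"
    by (auto simp: add_boxes_def)
next
  fix i assume "d < i"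
  then show "add_boxes g I i = 0"
    using g I by (auto simp: add_boxes_def addable_rows_def ptn_def)
qed

lemma shape_add_boxes:
  assumes "I \<subseteq> addable_rows d g"
  shows "shape (add_boxes g I) = shape g \<union> (\<lambda>i. (i, Suc (g i))) ` I"
  using assms by (auto simp: shape_def add_boxes_def addable_rows_def image_iff split: if_splits)

text \<open>A particle is blocked exactly when the row above has the same length.\<close>

lemma addable_particles:
  assumes g: "ptn d g"
  shows "addable (particles d g) = position d g ` addable_rows d g"
proof -
  have "Suc (position d g i) \<notin> particles d g \<longleftrightarrow> i \<in> addable_rows d g" if i: "i \<in> {1..d}" for i
  proof
    assume "i \<in> addable_rows d g"
    then have ins: "{i} \<subseteq> addable_rows d g" by simp
    have "add_boxes g {i} = g(i := Suc (g i))" by (auto simp: add_boxes_def)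
    then show "Suc (position d g i) \<notin> particles d g"
      using Suc_position_notin[OF g _ i] ptn_add_boxes[OF g ins] by simp
  next
    assume *: "Suc (position d g i) \<notin> particles d g"
    show "i \<in> addable_rows d g"
    proof (rule ccontr)
      assume "i \<notin> addable_rows d g"
      then have "i \<noteq> 1" "g (i - 1) \<le> g i" using i by (auto simp: addable_rows_def)
      moreover have "g i \<le> g (i - 1)" using ptn_mono[OF g, of "i - 1" i] i \<open>i \<noteq> 1\<close> by fastforce
      ultimately have "position d g (i - 1) = Suc (position d g i)" "i - 1 \<in> {1..d}"
        using i by (auto simp: position_def)
      then show False using * position_in by metis
    qed
  qed
  moreover have "addable_rows d g \<subseteq> {1..d}" by (auto simp: addable_rows_def)
  ultimately have "{i \<in> {1..d}. Suc (position d g i) \<notin> particles d g} = addable_rows d g"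
    by blast
  moreover have "addable (particles d g) = position d g ` {i \<in> {1..d}. Suc (position d g i) \<notin> particles d g}"
    by (auto simp: addable_def particles_def)
  ultimately show ?thesis by simp
qed

lemma mv_particles:
  assumes g: "ptn d g" and I: "I \<subseteq> {1..d}"
  shows "mv (particles d g) (position d g ` I) = particles d (add_boxes g I)"
proof -
  have "particles d g - position d g ` I = position d g ` ({1..d} - I)"
    unfolding particles_def using inj_on_image_set_diff[OF inj_on_position[OF g], of "{1..d}" I] I by auto
  also have "\<dots> = position d (add_boxes g I) ` ({1..d} - I)"
    by (intro image_cong) (auto simp: position_def add_boxes_def)
  finally have 1: "particles d g - position d g ` I = position d (add_boxes g I) ` ({1..d} - I)" .
  have 2: "Suc ` position d g ` I = position d (add_boxes g I) ` I"
    unfolding image_image using I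
    by (intro image_cong) (auto simp: position_def add_boxes_def Suc_diff_le)
  have "{1..d} = ({1..d} - I) \<union> I" using I by auto
  then show ?thesis unfolding mv_def 1 2 particles_def[of d "add_boxes g I"] by (metis image_Un)
qed

lemma up_sum_particles:
  assumes g: "ptn d g"
  shows "up_sum v (particles d g) = (\<Sum>I\<in>Pow (addable_rows d g). v (particles d (add_boxes g I)))"
proof -
  have sub: "addable_rows d g \<subseteq> {1..d}" by (auto simp: addable_rows_def)
  have inj: "inj_on (position d g) (addable_rows d g)"
    using inj_on_subset[OF inj_on_position[OF g] sub] .
  have "Pow (position d g ` addable_rows d g) = image (position d g) ` Pow (addable_rows d g)"
    by (simp add: image_Pow_surj)
  then have "up_sum v (particles d g)
      = (\<Sum>I\<in>Pow (addable_rows d g). v (mv (particles d g) (position d g ` I)))"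
    unfolding up_sum_def addable_particles[OF g]
    by (simp add: sum.reindex[OF inj_on_image_Pow[OF inj]])
  also have "\<dots> = (\<Sum>I\<in>Pow (addable_rows d g). v (particles d (add_boxes g I)))"
    using sub mv_particles[OF g] by (intro sum.cong) auto
  finally show ?thesis .
qed

text \<open>The conditions of \<open>SIT\<close> on an arbitrary set of cells, so that they also
  apply to what remains after the first layer is removed.\<close>

definition tableaux :: "(nat \<times> nat) set \<Rightarrow> (nat \<times> nat \<Rightarrow> nat) set" where
  "tableaux A = {T. (\<forall>c. c \<notin> A \<longrightarrow> T c = 0) \<and>
     (\<forall>i j. (i, j) \<in> A \<and> (i, j + 1) \<in> A \<longrightarrow> T (i, j) < T (i, j + 1)) \<and>
     (\<forall>i j. (i, j) \<in> A \<and> (i + 1, j) \<in> A \<longrightarrow> T (i, j) < T (i + 1, j)) \<and>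
     (\<exists>m. T ` A = {1..m})}"

lemma SIT_eq: "SIT la mu = tableaux (skew la mu)"
  by (simp add: SIT_def tableaux_def)

lemma tableaux_pos: "T \<in> tableaux A \<Longrightarrow> c \<in> A \<Longrightarrow> 1 \<le> T c"
  using imageI[of c A T] unfolding tableaux_def by auto

lemma tableaux_zero: "T \<in> tableaux A \<Longrightarrow> c \<notin> A \<Longrightarrow> T c = 0"
  unfolding tableaux_def by blast

lemma tableaux_row: "T \<in> tableaux A \<Longrightarrow> (i, j) \<in> A \<Longrightarrow> (i, Suc j) \<in> A \<Longrightarrow> T (i, j) < T (i, Suc j)"
  by (simp add: tableaux_def)

lemma tableaux_col: "T \<in> tableaux A \<Longrightarrow> (i, j) \<in> A \<Longrightarrow> (Suc i, j) \<in> A \<Longrightarrow> T (i, j) < T (Suc i, j)"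
  by (simp add: tableaux_def)

lemma finite_tableaux:
  assumes "finite A" shows "finite (tableaux A)"
proof (rule finite_subset)
  show "tableaux A \<subseteq> {T. \<forall>c. (c \<in> A \<longrightarrow> T c \<in> {0..card A}) \<and> (c \<notin> A \<longrightarrow> T c = 0)}"
  proof
    fix T assume T: "T \<in> tableaux A"
    then obtain m where m: "T ` A = {1..m}" by (auto simp: tableaux_def)
    then have "m \<le> card A" using card_image_le[OF assms, of T] by simp
    then have "T c \<in> {0..card A}" if "c \<in> A" for c
      using m that imageI[of c A T] by auto
    then show "T \<in> {T. \<forall>c. (c \<in> A \<longrightarrow> T c \<in> {0..card A}) \<and> (c \<notin> A \<longrightarrow> T c = 0)}"
      using T by (auto simp: tableaux_def)
  qed
  show "finite {T. \<forall>c. (c \<in> A \<longrightarrow> T c \<in> {0..card A}) \<and> (c \<notin> A \<longrightarrow> T c = (0::nat))}"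
    by (rule finite_set_of_finite_funs) (use assms in auto)
qed

lemma tableaux_empty: "tableaux {} = {\<lambda>_. 0}"
  by (auto simp: tableaux_def)

text \<open>Testing the leftmost skew cell of each row suffices, since no entry 1 stands further
  right (\<open>ones\<close>).\<close>

definition first_rows :: "(nat \<times> nat) set \<Rightarrow> (nat \<Rightarrow> nat) \<Rightarrow> (nat \<times> nat \<Rightarrow> nat) \<Rightarrow> nat set" where
  "first_rows A g T = {i. (i, Suc (g i)) \<in> A \<and> T (i, Suc (g i)) = 1}"

text \<open>Inverse to lowering all entries by 1: the cells of the removed layer hold the default
  value 0 and so become 1.\<close>

definition raise :: "(nat \<times> nat) set \<Rightarrow> (nat \<times> nat \<Rightarrow> nat) \<Rightarrow> nat \<times> nat \<Rightarrow> nat" where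
  "raise A T c = (if c \<in> A then Suc (T c) else 0)"

definition growths :: "nat \<Rightarrow> (nat \<Rightarrow> nat) \<Rightarrow> (nat \<Rightarrow> nat) \<Rightarrow> nat set set" where
  "growths d f g = {I. I \<subseteq> addable_rows d g \<and> I \<noteq> {} \<and> shape (add_boxes g I) \<subseteq> shape f}"

section \<open>The bijection of a tableau with its first layer and the lowered rest\<close>

locale skew_shape =
  fixes d :: nat and f g :: "nat \<Rightarrow> nat"
  assumes f: "ptn d f" and g: "ptn d g" and sub: "shape g \<subseteq> shape f" and ne: "shape g \<noteq> shape f"
begin

definition A :: "(nat \<times> nat) set" where "A = shape f - shape g"

definition B :: "nat set \<Rightarrow> (nat \<times> nat) set" where "B I = (\<lambda>i. (i, Suc (g i))) ` I"

lemma in_A: "(i, j) \<in> A \<longleftrightarrow> 1 \<le> i \<and> g i < j \<and> j \<le> f i"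
  by (auto simp: A_def shape_def)

lemma finite_A: "finite A"
  using finite_shape[OF f] by (simp add: A_def)

lemma in_B: "(i, j) \<in> B I \<longleftrightarrow> i \<in> I \<and> j = Suc (g i)"
  by (auto simp: B_def)

lemma growthsD:
  assumes "I \<in> growths d f g"
  shows "I \<subseteq> addable_rows d g" "I \<noteq> {}" "B I \<subseteq> A" "shape f - shape (add_boxes g I) = A - B I"
    "shape (add_boxes g I) = shape g \<union> B I"
proof -
  show I: "I \<subseteq> addable_rows d g" "I \<noteq> {}" using assms by (auto simp: growths_def)
  show sh: "shape (add_boxes g I) = shape g \<union> B I"
    using shape_add_boxes[OF I(1)] by (simp add: B_def)
  have "B I \<subseteq> shape f" using assms sh by (auto simp: growths_def)
  moreover have "B I \<inter> shape g = {}" by (auto simp: B_def shape_def)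
  ultimately show "B I \<subseteq> A" by (auto simp: A_def)
  show "shape f - shape (add_boxes g I) = A - B I" unfolding sh by (auto simp: A_def)
qed

lemma ones:
  assumes T: "T \<in> tableaux A"
  shows "{c \<in> A. T c = 1} = B (first_rows A g T)"
proof (intro equalityI subsetI)
  fix c assume c: "c \<in> {c \<in> A. T c = 1}"
  obtain i j where ij: "c = (i, j)" by force
  have "j = Suc (g i)"
  proof (rule ccontr)
    assume "j \<noteq> Suc (g i)"
    then obtain b where b: "j = Suc b" "(i, b) \<in> A" using c by (cases j) (auto simp: ij in_A)
    then have "T (i, b) < T (i, j)" using tableaux_row[OF T b(2)] c by (simp add: ij)
    then show False using tableaux_pos[OF T b(2)] c by (simp add: ij)
  qed
  then show "c \<in> B (first_rows A g T)" using c by (auto simp: ij in_B first_rows_def)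
qed (auto simp: B_def first_rows_def)

text \<open>If a row with a first entry 1 were not addable, the cell above that entry would lie in
  \<open>A\<close> and need a smaller positive entry. Some entry is 1 because \<open>A\<close> is
  nonempty.\<close>

lemma first_rows_growths:
  assumes T: "T \<in> tableaux A"
  shows "first_rows A g T \<in> growths d f g"
proof -
  let ?I = "first_rows A g T"
  have I: "?I \<subseteq> addable_rows d g"
  proof
    fix i assume i: "i \<in> ?I"
    then have iA: "(i, Suc (g i)) \<in> A" and T1: "T (i, Suc (g i)) = 1" by (auto simp: first_rows_def)
    then have "(i, Suc (g i)) \<in> shape f" by (simp add: A_def)
    then have id: "i \<in> {1..d}" using shape_row_le[OF f] by (auto simp: shape_def)
    show "i \<in> addable_rows d g"
    proof (rule ccontr)
      assume "i \<notin> addable_rows d g"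
      then have *: "i \<noteq> 1" "g (i - 1) \<le> g i" using id by (auto simp: addable_rows_def)
      then obtain k where k: "i = Suc k" "1 \<le> k" using id by (cases i) auto
      have "f i \<le> f k" using f k by (simp add: ptn_def)
      then have kA: "(k, Suc (g i)) \<in> A" using iA * k by (auto simp: in_A)
      then have "T (k, Suc (g i)) < T (Suc k, Suc (g i))" using tableaux_col[OF T] iA k by simp
      then show False using tableaux_pos[OF T kA] T1 k by simp
    qed
  qed
  have "A \<noteq> {}" using sub ne by (auto simp: A_def)
  moreover obtain m where m: "T ` A = {1..m}" using T by (auto simp: tableaux_def)
  ultimately have "1 \<le> m" by (metis atLeastatMost_empty_iff image_is_empty not_le)
  then have "1 \<in> T ` A" using m by simp
  then obtain c where "c \<in> A" "T c = 1" by (metis imageE)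
  then have "{c \<in> A. T c = 1} \<noteq> {}" by blast
  then have "?I \<noteq> {}" unfolding ones[OF T] by (auto simp: B_def)
  moreover have "shape (add_boxes g ?I) \<subseteq> shape f"
    unfolding shape_add_boxes[OF I] using sub by (auto simp: first_rows_def A_def)
  ultimately show ?thesis using I by (simp add: growths_def)
qed

lemma lower_tableaux:
  assumes T: "T \<in> tableaux A"
  shows "(\<lambda>c. T c - 1) \<in> tableaux (A - B (first_rows A g T))"
proof -
  let ?A = "A - B (first_rows A g T)"
  obtain m where m: "T ` A = {1..m}" using T by (auto simp: tableaux_def)
  have rest: "?A = {c \<in> A. T c \<noteq> 1}" using ones[OF T] by auto
  then have two: "2 \<le> T c" if "c \<in> ?A" for c using tableaux_pos[OF T, of c] that by auto
  have "T ` ?A = T ` A - {1}" unfolding rest by auto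
  also have "\<dots> = {2..m}" unfolding m by auto
  finally have "T ` ?A = {2..m}" .
  then have img: "(\<lambda>c. T c - 1) ` ?A = (\<lambda>x. x - 1) ` {2..m}"
    using image_image[of "\<lambda>x. x - 1" T ?A] by simp
  have "(\<lambda>x. x - 1) ` {2..m} = {1..m - 1}"
  proof (rule set_eqI)
    fix x
    have "x \<in> {1..m - 1} \<Longrightarrow> x = Suc x - 1 \<and> Suc x \<in> {2..m}" by auto
    then show "x \<in> (\<lambda>x. x - 1) ` {2..m} \<longleftrightarrow> x \<in> {1..m - 1}" by fastforce
  qed
  with img have ex: "\<exists>m. (\<lambda>c. T c - 1) ` ?A = {1..m}" by metis
  \<comment> \<open>Truncated subtraction sends both the removed entries 1 and the outside value 0
    to 0.\<close>
  have zero: "T c - 1 = 0" if "c \<notin> ?A" for c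
    using that tableaux_zero[OF T, of c] rest by (cases "c \<in> A") auto
  have lt: "T c - 1 < T c' - 1" if "c \<in> ?A" "c' \<in> ?A" "T c < T c'" for c c'
    using that(3) two[OF that(1)] by linarith
  show ?thesis
    unfolding tableaux_def using ex zero lt T unfolding tableaux_def by auto
qed

text \<open>The right or lower cell of an adjacent pair in \<open>A\<close> is never in the new
  layer, so its entry is at least 2 after raising. This settles pairs starting in the layer; all
  others are just shifted.\<close>

lemma raise_tableaux:
  assumes I: "I \<in> growths d f g" and T: "T \<in> tableaux (A - B I)"
  shows "raise A T \<in> tableaux A"
proof -
  note I = growthsD[OF I]
  obtain m where m: "T ` (A - B I) = {1..m}" using T by (auto simp: tableaux_def)
  have T0: "T c = 0" if "c \<in> B I" for c using tableaux_zero[OF T] that by simp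
  have "raise A T ` A = raise A T ` (A - B I) \<union> raise A T ` B I" using I(3) by blast
  also have "raise A T ` (A - B I) = Suc ` T ` (A - B I)"
    unfolding image_image by (intro image_cong) (auto simp: raise_def)
  also have "\<dots> = {2..Suc m}" unfolding m by (simp add: numeral_2_eq_2)
  also have "raise A T ` B I = {1}"
    using I(2,3) T0 by (auto simp: raise_def B_def image_iff)
  also have "{2..Suc m} \<union> {1} = {1..Suc m}" by auto
  finally have ex: "\<exists>m. raise A T ` A = {1..m}" by blast
  have row: "raise A T (i, j) < raise A T (i, j + 1)" if *: "(i, j) \<in> A" "(i, j + 1) \<in> A" for i j
  proof -
    have b: "(i, j + 1) \<in> A - B I" using * by (auto simp: in_A in_B)
    show ?thesis
    proof (cases "(i, j) \<in> B I")
      case True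
      then show ?thesis using * T0 tableaux_pos[OF T b] by (simp add: raise_def)
    next
      case False
      then have "T (i, j) < T (i, j + 1)" using tableaux_row[OF T, of i j] * b by simp
      then show ?thesis using * by (simp add: raise_def)
    qed
  qed
  have col: "raise A T (i, j) < raise A T (i + 1, j)" if *: "(i, j) \<in> A" "(i + 1, j) \<in> A" for i j
  proof -
    have "(i + 1, j) \<notin> B I"
      using * I(1) by (auto simp: in_A in_B addable_rows_def)
    then have b: "(i + 1, j) \<in> A - B I" using * by simp
    show ?thesis
    proof (cases "(i, j) \<in> B I")
      case True
      then show ?thesis using * T0 tableaux_pos[OF T b] by (simp add: raise_def)
    next
      case False
      then have "T (i, j) < T (i + 1, j)" using tableaux_col[OF T, of i j] * b by simp
      then show ?thesis using * by (simp add: raise_def)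
    qed
  qed
  show ?thesis
    unfolding tableaux_def using ex row col by (auto simp: raise_def)
qed

lemma raise_lower:
  assumes T: "T \<in> tableaux A"
  shows "raise A (\<lambda>c. T c - 1) = T"
proof
  fix c show "raise A (\<lambda>c. T c - 1) c = T c"
    using tableaux_zero[OF T, of c] tableaux_pos[OF T, of c] by (cases "c \<in> A") (auto simp: raise_def)
qed

lemma lower_raise:
  assumes I: "I \<in> growths d f g" and T: "T \<in> tableaux (A - B I)"
  shows "first_rows A g (raise A T) = I" "(\<lambda>c. raise A T c - 1) = T"
proof -
  note I = growthsD[OF I]
  have T0: "T c = 0" if "c \<notin> A - B I" for c using tableaux_zero[OF T] that by simp
  show "first_rows A g (raise A T) = I"
  proof (rule set_eqI)
    fix i
    show "i \<in> first_rows A g (raise A T) \<longleftrightarrow> i \<in> I"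
    proof (cases "i \<in> I")
      case True
      then have "(i, Suc (g i)) \<in> B I" by (simp add: in_B)
      then show ?thesis using True I(3) T0 by (auto simp: first_rows_def raise_def)
    next
      case False
      then have "1 \<le> T (i, Suc (g i))" if "(i, Suc (g i)) \<in> A"
        using that by (intro tableaux_pos[OF T]) (auto simp: in_B)
      then show ?thesis using False by (auto simp: first_rows_def raise_def)
    qed
  qed
  show "(\<lambda>c. raise A T c - 1) = T"
    using T0 by (auto simp: raise_def)
qed

text \<open>Raising shifts the level sets by one, so factor \<open>Suc k\<close> of the raised
  tableau is factor \<open>k\<close> of the smaller one.\<close>

lemma levels_raise:
  assumes I: "I \<in> growths d f g" and T: "T \<in> tableaux (A - B I)"
  shows "card (raise A T ` A) = Suc (card (T ` (A - B I)))"
    and "shape g \<union> {c \<in> A. raise A T c < 1} = shape g"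
    and "1 \<le> k \<Longrightarrow> shape g \<union> {c \<in> A. raise A T c < Suc k}
      = shape (add_boxes g I) \<union> {c \<in> A - B I. T c < k}"
proof -
  have T': "raise A T \<in> tableaux A" by (rule raise_tableaux[OF assms])
  have T0: "T c = 0" if "c \<in> B I" for c using tableaux_zero[OF T] that by simp
  note I = growthsD[OF I]
  have "raise A T ` A = Suc ` T ` A"
    unfolding image_image by (intro image_cong) (auto simp: raise_def)
  also have "T ` A = insert 0 (T ` (A - B I))"
  proof -
    have "T ` A = T ` B I \<union> T ` (A - B I)" using I(3) by blast
    also have "T ` B I = {0}" using T0 I(2) by (auto simp: B_def image_iff)
    finally show ?thesis by simp
  qed
  finally have "card (raise A T ` A) = card (insert 0 (T ` (A - B I)))"
    by (simp only: card_image[OF inj_on_subset[OF inj_Suc subset_UNIV]])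
  moreover have "0 \<notin> T ` (A - B I)" using tableaux_pos[OF T] by fastforce
  ultimately show "card (raise A T ` A) = Suc (card (T ` (A - B I)))"
    using finite_A by simp
  show "shape g \<union> {c \<in> A. raise A T c < 1} = shape g" by (auto simp: raise_def)
  show "shape g \<union> {c \<in> A. raise A T c < Suc k} = shape (add_boxes g I) \<union> {c \<in> A - B I. T c < k}"
    if "1 \<le> k"
    unfolding I(5) using T0 I(3) that by (auto simp: raise_def)
qed

text \<open>The factor for \<open>k = 1\<close> sees only \<open>shape g\<close> and is common to
  all tableaux; the other factors belong to the tableau on the remaining cells.\<close>

lemma sum_tableaux:
  fixes \<phi> :: "(nat \<times> nat) set \<Rightarrow> 'a::comm_semiring_1"
  shows "(\<Sum>T\<in>tableaux A. \<Prod>k=1..card (T ` A). \<phi> (shape g \<union> {c \<in> A. T c < k}))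
    = \<phi> (shape g) * (\<Sum>I\<in>growths d f g. \<Sum>T\<in>tableaux (A - B I).
        \<Prod>k=1..card (T ` (A - B I)). \<phi> (shape (add_boxes g I) \<union> {c \<in> A - B I. T c < k}))"
proof -
  let ?S = "Sigma (growths d f g) (\<lambda>I. tableaux (A - B I))"
  let ?w = "\<lambda>I T. \<Prod>k=1..card (T ` (A - B I)). \<phi> (shape (add_boxes g I) \<union> {c \<in> A - B I. T c < k})"
  have step: "(\<Prod>k=1..card (raise A T ` A). \<phi> (shape g \<union> {c \<in> A. raise A T c < k}))
      = \<phi> (shape g) * ?w I T" if "I \<in> growths d f g" "T \<in> tableaux (A - B I)" for I T
  proof -
    let ?h = "\<lambda>k. \<phi> (shape g \<union> {c \<in> A. raise A T c < k})"
    let ?n = "card (T ` (A - B I))"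
    have "(\<Prod>k=1..card (raise A T ` A). ?h k) = ?h 1 * (\<Prod>k=Suc 1..Suc ?n. ?h k)"
      unfolding levels_raise(1)[OF that] by (rule prod.atLeast_Suc_atMost) simp
    also have "(\<Prod>k=Suc 1..Suc ?n. ?h k) = (\<Prod>k=1..?n. ?h (Suc k))"
      by (rule prod.shift_bounds_cl_Suc_ivl)
    also have "?h 1 = \<phi> (shape g)" using levels_raise(2)[OF that] by simp
    also have "(\<Prod>k=1..card (T ` (A - B I)). ?h (Suc k)) = ?w I T"
      using levels_raise(3)[OF that] by (intro prod.cong) auto
    finally show ?thesis .
  qed
  have "(\<Sum>T\<in>tableaux A. \<Prod>k=1..card (T ` A). \<phi> (shape g \<union> {c \<in> A. T c < k}))
      = (\<Sum>(I, T)\<in>?S. \<phi> (shape g) * ?w I T)"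
  proof (rule sum.reindex_bij_witness[where i = "\<lambda>(I, T). raise A T"
        and j = "\<lambda>T. (first_rows A g T, \<lambda>c. T c - 1)"])
    fix T assume T: "T \<in> tableaux A"
    show "(case (first_rows A g T, \<lambda>c. T c - 1) of (I, T) \<Rightarrow> raise A T) = T"
      using raise_lower[OF T] by simp
    show "(first_rows A g T, \<lambda>c. T c - 1) \<in> ?S"
      using first_rows_growths[OF T] lower_tableaux[OF T] by simp
    show "(case (first_rows A g T, \<lambda>c. T c - 1) of (I, T) \<Rightarrow> \<phi> (shape g) * ?w I T)
        = (\<Prod>k=1..card (T ` A). \<phi> (shape g \<union> {c \<in> A. T c < k}))"
      using step[OF first_rows_growths[OF T] lower_tableaux[OF T]]
      unfolding raise_lower[OF T] by simp
  next
    fix p assume "p \<in> ?S"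
    then obtain I T where p: "p = (I, T)" "I \<in> growths d f g" "T \<in> tableaux (A - B I)" by auto
    show "(first_rows A g (case p of (I, T) \<Rightarrow> raise A T), \<lambda>c. (case p of (I, T) \<Rightarrow> raise A T) c - 1) = p"
      using lower_raise[OF p(2,3)] by (simp add: p(1))
    show "(case p of (I, T) \<Rightarrow> raise A T) \<in> tableaux A"
      using raise_tableaux[OF p(2,3)] by (simp add: p(1))
  qed
  also have "\<dots> = (\<Sum>I\<in>growths d f g. \<Sum>T\<in>tableaux (A - B I). \<phi> (shape g) * ?w I T)"
  proof (rule sum.Sigma[symmetric])
    show "finite (growths d f g)"
      by (rule finite_subset[of _ "Pow {1..d}"]) (auto simp: growths_def addable_rows_def)
    show "\<forall>I\<in>growths d f g. finite (tableaux (A - B I))"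
      using finite_tableaux finite_A by simp
  qed
  finally show ?thesis by (simp add: sum_distrib_left)
qed

text \<open>Take the topmost row \<open>i\<close> with \<open>g i < f i\<close>. If there is a row
  above, then \<open>g i < f i \<le> f (i - 1) \<le> g (i - 1)\<close>, so the row is
  addable.\<close>

lemma growths_nonempty: "growths d f g \<noteq> {}"
proof -
  have "\<exists>i. 1 \<le> i \<and> g i < f i"
  proof -
    have "A \<noteq> {}" using sub ne by (auto simp: A_def)
    then show ?thesis by (fastforce simp: in_A)
  qed
  note ex = this
  define i where "i = (LEAST i. 1 \<le> i \<and> g i < f i)"
  have i: "1 \<le> i" "g i < f i" using LeastI_ex[OF ex] by (simp_all add: i_def)
  have min: "f k \<le> g k" if "1 \<le> k" "k < i" for k
    using not_less_Least[OF that(2)[unfolded i_def]] that(1) by auto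
  have "i \<le> d" using i f by (metis not_le not_less_zero ptn_zero)
  have "i = 1 \<or> g i < g (i - 1)"
    using i min[of "i - 1"] ptn_mono[OF f, of "i - 1" i] by fastforce
  then have I: "{i} \<subseteq> addable_rows d g" using i \<open>i \<le> d\<close> by (auto simp: addable_rows_def)
  have "(i, Suc (g i)) \<in> shape f" using i by (simp add: shape_def)
  then have "{i} \<in> growths d f g"
    using I sub by (simp add: growths_def shape_add_boxes[OF I])
  then show ?thesis by blast
qed

end

section \<open>Comparison of the two sides\<close>

definition row_count :: "(nat \<times> nat) set \<Rightarrow> nat \<Rightarrow> nat" where
  "row_count M i = card {j. (i, j) \<in> M}"

text \<open>Takes a set of cells, since the levels of a tableau are given as such; on diagrams it is
  the quotient of the two products over particles (\<open>ratio_shape\<close>).\<close>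

definition ratio :: "nat \<Rightarrow> (nat \<Rightarrow> nat) \<Rightarrow> (nat \<Rightarrow> 'a::field) \<Rightarrow> (nat \<times> nat) set \<Rightarrow> 'a" where
  "ratio d f z M = (\<Prod>i=1..d. z (row_count M i + d - i + 1) / z (f i + d - i + 1))"

lemma row_count_shape: "1 \<le> i \<Longrightarrow> row_count (shape g) i = g i"
proof -
  assume "1 \<le> i"
  then have "{j. (i, j) \<in> shape g} = {1..g i}" by (auto simp: shape_def)
  then show ?thesis by (simp add: row_count_def)
qed

lemma particles_cong:
  assumes "shape f = shape g" shows "particles d f = particles d g"
proof -
  have "f i = g i" if "1 \<le> i" for i
    using row_count_shape[OF that, of f] row_count_shape[OF that, of g] assms by simp
  then show ?thesis by (auto simp: particles_def position_def)
qed

lemma prod_particles: "ptn d g \<Longrightarrow> prod z (particles d g) = (\<Prod>i=1..d. z (position d g i))"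
  unfolding particles_def using prod.reindex[OF inj_on_position, of d g z] by (simp add: comp_def)

lemma ratio_shape:
  assumes "ptn d f" "ptn d g"
  shows "ratio d f z (shape g) = prod z (particles d g) / prod z (particles d f)"
proof -
  have "ratio d f z (shape g) = (\<Prod>i=1..d. z (position d g i) / z (position d f i))"
    unfolding ratio_def by (intro prod.cong) (auto simp: row_count_shape position_def)
  then show ?thesis by (simp add: prod_dividef prod_particles assms)
qed

text \<open>Every state reached by reading cells of \<open>f\<close> is the configuration of a
  partition inside \<open>f\<close>.\<close>

lemma state_sum_outside:
  assumes f: "ptn d f" and la: "diagram la = shape f" and h: "ptn d h" "\<not> shape h \<subseteq> shape f"
  shows "state_sum d (cells f) u (particles d h) = 0"
proof -
  have "{D. D \<subseteq> set (cells f) \<and> run d (cells f) D = Some (particles d h)} = {}"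
  proof (rule ccontr)
    assume "\<not> ?thesis"
    then obtain D where D: "D \<subseteq> shape f" "run d (cells f) D = Some (particles d h)"
      using cells_simps(1)[OF f] by auto
    then obtain g where "ptn d g" "shape g \<subseteq> shape f" "particles d h = particles d g"
      using run_Some[OF f la D] by blast
    then show False using particles_inject[OF h(1)] h(2) by metis
  qed
  then show ?thesis unfolding state_sum_def by (simp only: sum.empty)
qed

text \<open>The recurrence with the term of the empty move brought to the left; growths that leave
  \<open>f\<close> contribute 0.\<close>

lemma state_sum_growths:
  fixes d :: nat and f :: "nat \<Rightarrow> nat" and z :: "nat \<Rightarrow> 'a::field"
  defines "v \<equiv> state_sum d (cells f) (weight d f z)"
  assumes f: "ptn d f" and la: "diagram la = shape f" and g: "ptn d g" and sub: "shape g \<subseteq> shape f"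
    and nz: "\<And>q. q \<in> particles d f \<Longrightarrow> z q \<noteq> 0"
  shows "(ratio d f z (shape g) - 1) * v (particles d g)
    = (\<Sum>I\<in>growths d f g. v (particles d (add_boxes g I)))"
proof -
  let ?P = "Pow (addable_rows d g)"
  have fin: "finite (addable_rows d g)" by (simp add: addable_rows_def)
  have nz': "prod z (particles d f) \<noteq> 0" using nz by (simp add: particles_def)
  have g0: "add_boxes g {} = g" by (auto simp: add_boxes_def)
  have "prod z (particles d g) * v (particles d g) = prod z (particles d f) * up_sum v (particles d g)"
    unfolding v_def using f nz by (rule state_sum_recurrence) (auto simp: particles_def position_def)
  then have "ratio d f z (shape g) * v (particles d g) = up_sum v (particles d g)"
    using nz' by (simp add: ratio_shape f g field_simps)
  also have "\<dots> = (\<Sum>I\<in>?P. v (particles d (add_boxes g I)))" by (rule up_sum_particles[OF g])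
  also have "\<dots> = v (particles d g) + (\<Sum>I\<in>?P - {{}}. v (particles d (add_boxes g I)))"
    using fin by (subst sum.remove[of _ "{}"]) (auto simp: g0)
  also have "(\<Sum>I\<in>?P - {{}}. v (particles d (add_boxes g I)))
      = (\<Sum>I\<in>growths d f g. v (particles d (add_boxes g I)))"
  proof (rule sum.mono_neutral_right)
    show "\<forall>I\<in>?P - {{}} - growths d f g. v (particles d (add_boxes g I)) = 0"
      unfolding v_def using state_sum_outside[OF f la] ptn_add_boxes[OF g]
      by (auto simp: growths_def)
  qed (use fin in \<open>auto simp: growths_def\<close>)
  finally show ?thesis by (simp add: algebra_simps)
qed

text \<open>Both sides obey the same recursion over first layers. Nonemptiness is carried along
  because the nonvanishing hypothesis speaks only about factors of existing tableaux: one tableau is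
  needed to divide by \<open>ratio d f z (shape g) - 1\<close>, its factor for
  \<open>k = 1\<close>.\<close>

lemma tableaux_sum_eq:
  fixes d :: nat and f :: "nat \<Rightarrow> nat" and z :: "nat \<Rightarrow> 'a::field"
  defines "v \<equiv> state_sum d (cells f) (weight d f z)"
  assumes f: "ptn d f" and la: "diagram la = shape f" and nz: "\<And>q. q \<in> particles d f \<Longrightarrow> z q \<noteq> 0"
    and top: "v (particles d f) \<noteq> 0"
    and g: "ptn d g" and sub: "shape g \<subseteq> shape f"
    and ratio: "\<And>T k. T \<in> tableaux (shape f - shape g) \<Longrightarrow> k \<in> {1..card (T ` (shape f - shape g))} \<Longrightarrow>
      ratio d f z (shape g \<union> {c \<in> shape f - shape g. T c < k}) - 1 \<noteq> 0"
  shows "tableaux (shape f - shape g) \<noteq> {} \<and>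
    (\<Sum>T\<in>tableaux (shape f - shape g). \<Prod>k=1..card (T ` (shape f - shape g)).
      inverse (ratio d f z (shape g \<union> {c \<in> shape f - shape g. T c < k}) - 1))
    = v (particles d g) / v (particles d f)"
  using g sub ratio
proof (induction "card (shape f - shape g)" arbitrary: g rule: less_induct)
  case less
  show ?case
  proof (cases "shape g = shape f")
    case True
    then have "particles d g = particles d f" by (rule particles_cong)
    then show ?thesis using True top by (simp add: tableaux_empty)
  next
    case False
    interpret skew_shape d f g using f less.prems(1,2) False by unfold_locales
    note prems = less.prems(3)[folded A_def]
    let ?h = "\<lambda>M. inverse (ratio d f z M - 1)"
    have IH: "tableaux (A - B I) \<noteq> {} \<and>
        (\<Sum>T\<in>tableaux (A - B I). \<Prod>k=1..card (T ` (A - B I)).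
          ?h (shape (add_boxes g I) \<union> {c \<in> A - B I. T c < k}))
        = v (particles d (add_boxes g I)) / v (particles d f)"
      if I: "I \<in> growths d f g" for I
    proof (rule less.hyps[of "add_boxes g I", unfolded growthsD(4)[OF I]])
      note I' = growthsD[OF I]
      have "B I \<noteq> {}" using I'(2) by (simp add: B_def)
      then have "A - B I \<subset> A" using I'(3) by blast
      then show "card (A - B I) < card (shape f - shape g)"
        unfolding A_def[symmetric] by (rule psubset_card_mono[OF finite_A])
      show "ptn d (add_boxes g I)" by (rule ptn_add_boxes[OF less.prems(1) I'(1)])
      show "shape (add_boxes g I) \<subseteq> shape f" using I by (simp add: growths_def)
      fix T k assume T: "T \<in> tableaux (A - B I)" and k: "k \<in> {1..card (T ` (A - B I))}"
      \<comment> \<open>The factor \<open>k\<close> of \<open>T\<close> is nonzero as the factor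
        \<open>Suc k\<close> of the raised tableau.\<close>
      have "Suc k \<in> {1..card (raise A T ` A)}" using levels_raise(1)[OF I T] k by simp
      from prems[OF raise_tableaux[OF I T] this]
      show "ratio d f z (shape (add_boxes g I) \<union> {c \<in> A - B I. T c < k}) - 1 \<noteq> 0"
        using levels_raise(3)[OF I T, of k] k by simp
    qed
    obtain I where I: "I \<in> growths d f g" using growths_nonempty by blast
    then obtain T where T: "T \<in> tableaux (A - B I)" using IH by blast
    have raised: "raise A T \<in> tableaux A" by (rule raise_tableaux[OF I T])
    have "ratio d f z (shape g \<union> {c \<in> A. raise A T c < 1}) - 1 \<noteq> 0"
      by (rule prems[OF raised]) (simp add: levels_raise(1)[OF I T])
    then have r: "ratio d f z (shape g) - 1 \<noteq> 0"
      unfolding levels_raise(2)[OF I T] .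
    have eq: "(ratio d f z (shape g) - 1) * v (particles d g)
        = (\<Sum>I\<in>growths d f g. v (particles d (add_boxes g I)))"
      unfolding v_def by (rule state_sum_growths[OF f la less.prems(1,2)]) (rule nz)
    have "(\<Sum>T\<in>tableaux A. \<Prod>k=1..card (T ` A). ?h (shape g \<union> {c \<in> A. T c < k}))
        = ?h (shape g) * (\<Sum>I\<in>growths d f g. v (particles d (add_boxes g I)) / v (particles d f))"
      unfolding sum_tableaux[of ?h] using IH by (intro arg_cong2[where f = times] sum.cong refl) blast
    also have "\<dots> = ?h (shape g) * ((ratio d f z (shape g) - 1) * v (particles d g)) / v (particles d f)"
      unfolding eq by (simp only: sum_divide_distrib[symmetric] times_divide_eq_right)
    also have "\<dots> = v (particles d g) / v (particles d f)"
      using r by simp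
    finally show ?thesis using raised unfolding A_def by blast
  qed
qed

section \<open>From lists of parts to functions, and the final identity\<close>

lemma ptn_part:
  assumes "is_partition la" "length la \<le> d"
  shows "ptn d (part la)"
  unfolding ptn_def
proof (intro conjI allI impI)
  fix i :: nat assume "1 \<le> i"
  then show "part la (Suc i) \<le> part la i"
    using assms(1) unfolding is_partition_def part_def
    by (auto simp: sorted_wrt_iff_nth_less)
qed (use assms(2) in \<open>simp add: part_def\<close>)

lemma diagram_eq_shape: "diagram la = shape (part la)"
  by (simp add: diagram_def shape_def)

lemma conj_part_eq:
  assumes "length la \<le> d" "1 \<le> j"
  shows "conj_part la j = col_length d (part la) j"
  unfolding conj_part_def col_length_def using assms
  by (intro arg_cong[where f = card]) (auto simp: part_def split: if_splits)

text \<open>The full diagram admits no move, so the coefficient at the top is the product of all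
  weights. Dividing the product over \<open>D\<close> by it leaves the inverse weights of the
  complement.\<close>

lemma excited_sum_eq:
  fixes d :: nat and f :: "nat \<Rightarrow> nat" and z :: "nat \<Rightarrow> 'a::field"
  defines "v \<equiv> state_sum d (cells f) (weight d f z)"
  assumes f: "ptn d f" and la: "diagram la = shape f" and g: "ptn d g" and mu: "diagram mu = shape g"
    and sub: "shape g \<subseteq> shape f"
    and nz: "\<And>c. c \<in> shape f \<Longrightarrow> weight d f z c \<noteq> 0"
  shows "v (particles d f) = prod (weight d f z) (shape f)"
    and "(\<Sum>D\<in>gen_excited la mu. \<Prod>c\<in>shape f - D. inverse (weight d f z c))
      = v (particles d g) / v (particles d f)"
proof -
  have fin: "finite (shape f)" by (rule finite_shape[OF f])
  have v: "v (particles d h) = sum (prod (weight d f z)) (gen_excited la nu)"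
    if "ptn d h" "diagram nu = shape h" "shape h \<subseteq> shape f" for h nu
    unfolding v_def state_sum_def cells_simps(1)[OF f] gen_excited_eq[OF f la that] ..
  have "D = diagram la" if "D \<in> gen_excited la la" for D
    using that by induction (auto simp: active_def)
  then have "gen_excited la la = {diagram la}"
    using gen_excited.init[of la la] by blast
  then show top: "v (particles d f) = prod (weight d f z) (shape f)"
    using v[OF f la] by (simp add: la)
  have nz': "prod (weight d f z) (shape f) \<noteq> 0" using fin nz by simp
  have "(\<Prod>c\<in>shape f - D. inverse (weight d f z c)) = prod (weight d f z) D / prod (weight d f z) (shape f)"
    if "D \<in> gen_excited la mu" for D
  proof -
    have "D \<subseteq> shape f" using that gen_excited_run[OF f la g mu sub] by blast
    then have *: "prod (weight d f z) (shape f) = prod (weight d f z) (shape f - D) * prod (weight d f z) D"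
      using fin by (rule prod.subset_diff)
    have "prod (weight d f z) (shape f - D) \<noteq> 0" "prod (weight d f z) D \<noteq> 0"
      using nz' unfolding * by auto
    moreover have "(\<Prod>c\<in>shape f - D. inverse (weight d f z c)) = inverse (prod (weight d f z) (shape f - D))"
      using prod_inversef[of "weight d f z" "shape f - D"] by (simp add: comp_def)
    ultimately show ?thesis unfolding * by (simp add: field_simps)
  qed
  then show "(\<Sum>D\<in>gen_excited la mu. \<Prod>c\<in>shape f - D. inverse (weight d f z c))
      = v (particles d g) / v (particles d f)"
    unfolding top v[OF g mu sub] by (simp add: sum_divide_distrib)
qed

text \<open>The identity of rational functions is rendered by values in an arbitrary field where
  \<beta> and the denominators are nonzero.\<close>

theorem theorem6p5:
  fixes d :: nat and la mu :: "nat list" and \<beta> :: "'a :: field" and y :: "nat \<Rightarrow> 'a"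
  assumes "d \<ge> 1"
    and "is_partition la" and "is_partition mu"
    and "diagram mu \<subseteq> diagram la"
    and "length la \<le> d"
    and "\<beta> \<noteq> 0"
    and "\<forall>i\<in>{1..d}. 1 + \<beta> * y (part la i + d - i + 1) \<noteq> 0"
    and "\<forall>T\<in>SIT la mu. \<forall>k\<in>{1..mT la mu T}.
           (\<Prod>i=1..d. (1 + \<beta> * y (nu_part la mu T k i + d - i + 1))
                        / (1 + \<beta> * y (part la i + d - i + 1))) - 1 \<noteq> 0"
    and "\<forall>(i, j)\<in>diagram la.
           y (d + j - conj_part la j) - y (part la i + d + 1 - i) \<noteq> 0"
  shows "(\<Sum>T\<in>SIT la mu. \<Prod>k=1..mT la mu T.
            inverse ((\<Prod>i=1..d. (1 + \<beta> * y (nu_part la mu T k i + d - i + 1))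
                        / (1 + \<beta> * y (part la i + d - i + 1))) - 1))
       = (\<Sum>D\<in>gen_excited la mu.
            \<beta> powi (int (card D) - int (card (diagram la))) *
            (\<Prod>(i, j)\<in>diagram la - D.
               (\<beta> * y (part la i + d - i + 1) + 1)
               / (y (d + j - conj_part la j) - y (part la i + d + 1 - i))))"
proof -
  let ?f = "part la" and ?g = "part mu"
  define z where "z q = 1 + \<beta> * y q" for q
  let ?v = "state_sum d (cells ?f) (weight d ?f z)"
  have f: "ptn d ?f" using assms(2,5) by (rule ptn_part)
  have la: "diagram la = shape ?f" and mu: "diagram mu = shape ?g"
    by (rule diagram_eq_shape)+
  have sub: "shape ?g \<subseteq> shape ?f" using assms(4) by (simp add: la mu)
  \<comment> \<open>The last part of \<open>mu\<close> is positive, so row \<open>length mu\<close>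
    contains a cell, and this cell lies in \<open>la\<close>.\<close>
  have "length mu \<le> d"
  proof (cases "mu = []")
    case False
    then have len: "1 \<le> length mu" by (simp add: Suc_le_eq)
    then have "part mu (length mu) = last mu" using False by (simp add: part_def last_conv_nth)
    moreover have "last mu \<noteq> 0" using assms(3) last_in_set[OF False] by (metis is_partition_def)
    ultimately have "(length mu, 1) \<in> shape ?g" using len by (simp add: shape_def Suc_le_eq)
    then show ?thesis using sub shape_row_le[OF f] by blast
  qed simp
  with assms(3) have g: "ptn d ?g" by (rule ptn_part)
  have nz: "z q \<noteq> 0" if "q \<in> particles d ?f" for q
    using that assms(7) by (auto simp: particles_def position_def z_def)
  \<comment> \<open>In the quotient of two values of \<open>z\<close> minus 1 the constants cancel,
    which leaves \<beta> times a difference of two values of \<open>y\<close>.\<close>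
  have inv_weight: "inverse (weight d ?f z (i, j)) = inverse \<beta> *
      ((\<beta> * y (?f i + d - i + 1) + 1) / (y (d + j - conj_part la j) - y (?f i + d + 1 - i)))
      \<and> weight d ?f z (i, j) \<noteq> 0"
    if c: "(i, j) \<in> shape ?f" for i j
  proof -
    have ij: "1 \<le> i" "1 \<le> j" "i \<le> d" using c shape_row_le[OF f c] by (auto simp: shape_def)
    define a b where "a = y (?f i + d - i + 1)" and "b = y (d + j - conj_part la j)"
    have pos: "?f i + d + 1 - i = ?f i + d - i + 1" using ij by simp
    have ba: "b - a \<noteq> 0" using assms(9) c unfolding a_def b_def la pos[symmetric] by blast
    have a1: "1 + \<beta> * a \<noteq> 0" using assms(7) ij by (simp add: a_def)
    have "weight d ?f z (i, j) = (1 + \<beta> * b) / (1 + \<beta> * a) - 1"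
      using conj_part_eq[OF assms(5) ij(2)] by (simp add: weight_def z_def a_def b_def position_def)
    also have "\<dots> = \<beta> * (b - a) / (1 + \<beta> * a)" using a1 by (simp add: field_simps)
    finally have w: "weight d ?f z (i, j) = \<beta> * (b - a) / (1 + \<beta> * a)" .
    show ?thesis
      unfolding w pos a_def[symmetric] b_def[symmetric] using a1 ba assms(6) by (simp add: field_simps)
  qed
  then have wnz: "weight d ?f z c \<noteq> 0" if "c \<in> shape ?f" for c
    using that by (cases c) auto
  note ex = excited_sum_eq[OF f la g mu sub, of z, OF wnz]
  have top: "?v (particles d ?f) \<noteq> 0"
    using ex(1) wnz finite_shape[OF f] by simp
  have skew: "skew la mu = shape ?f - shape ?g" by (simp add: skew_def la mu)
  have ratio: "(\<Prod>i=1..d. (1 + \<beta> * y (nu_part la mu T k i + d - i + 1)) / (1 + \<beta> * y (part la i + d - i + 1)))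
      = ratio d ?f z (shape ?g \<union> {c \<in> shape ?f - shape ?g. T c < k})" for T k
    unfolding ratio_def nu_part_def row_count_def z_def skew mu ..
  have "(\<Sum>T\<in>SIT la mu. \<Prod>k=1..mT la mu T.
            inverse ((\<Prod>i=1..d. (1 + \<beta> * y (nu_part la mu T k i + d - i + 1))
                        / (1 + \<beta> * y (part la i + d - i + 1))) - 1))
      = ?v (particles d ?g) / ?v (particles d ?f)"
    using tableaux_sum_eq[of d ?f la z ?g, OF f la nz top g sub] assms(8)
    unfolding ratio SIT_eq mT_def skew by blast
  also have "\<dots> = (\<Sum>D\<in>gen_excited la mu. \<Prod>c\<in>shape ?f - D. inverse (weight d ?f z c))"
    using ex(2) by simp
  also have "\<dots> = (\<Sum>D\<in>gen_excited la mu.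
            \<beta> powi (int (card D) - int (card (diagram la))) *
            (\<Prod>(i, j)\<in>diagram la - D.
               (\<beta> * y (part la i + d - i + 1) + 1)
               / (y (d + j - conj_part la j) - y (part la i + d + 1 - i))))"
  proof (rule sum.cong[OF refl])
    fix D assume "D \<in> gen_excited la mu"
    then have D: "D \<subseteq> shape ?f" using gen_excited_run[OF f la g mu sub] by blast
    have fin: "finite (shape ?f)" by (rule finite_shape[OF f])
    let ?u = "\<lambda>(i, j). (\<beta> * y (?f i + d - i + 1) + 1) / (y (d + j - conj_part la j) - y (?f i + d + 1 - i))"
    have "card (shape ?f) = card (shape ?f - D) + card D"
      using D fin by (metis card_Diff_subset card_mono finite_subset le_add_diff_inverse2)
    \<comment> \<open>Each cell outside \<open>D\<close> contributes one factor
      \<open>inverse \<beta>\<close>; the exponent in the theorem is minus the number of these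
      cells.\<close>
    then have pow: "\<beta> powi (int (card D) - int (card (shape ?f))) = inverse \<beta> ^ card (shape ?f - D)"
      by (simp add: power_int_minus power_inverse)
    have "(\<Prod>c\<in>shape ?f - D. inverse (weight d ?f z c)) = (\<Prod>c\<in>shape ?f - D. inverse \<beta> * ?u c)"
      using inv_weight by (intro prod.cong) auto
    also have "\<dots> = inverse \<beta> ^ card (shape ?f - D) * (\<Prod>c\<in>shape ?f - D. ?u c)"
      by (simp add: prod.distrib)
    finally show "(\<Prod>c\<in>shape ?f - D. inverse (weight d ?f z c))
        = \<beta> powi (int (card D) - int (card (diagram la))) * (\<Prod>c\<in>diagram la - D. ?u c)"
      by (simp only: la pow)
  qed
  finally show ?thesis .
qed

end
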